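(* For every measurable function $f:\mathbb{W}\to\mathbb{R}$ such that $\mathbb{E}_\nu\left[(|f|+1)e^{-f}\right]<\infty$ and $$-\log\mathbb{E}_\nu\left[e^{-f}\right]=\inf_{u\in\mathcal{D}^i}\mathbb{E}_\nu\left[f\circ W^u+\frac12|u|_H^2\right],$$ we have $$-\log\mathbb{E}_\nu\left[e^{-f}\right]=\inf_{u\in\widetilde{\mathcal{D}}\cap L^2_a(\nu,H)}\mathbb{E}_\nu\left[f\circ W^u+\frac12|u|_H^2\right].$$
   Context: Notation. Let $n\ge 1$, $\mathbb{W}=C([0,1],\mathbb{R}^n)$, $H=\{\int_0^\cdot\dot h(s)ds:\dot h\in L^2([0,1],\mathbb{R}^n)\}$ with $|h|_H^2=\int_0^1|\dot h(s)|^2ds$. $W=(W(t))_{t\in[0,1]}$ is the coordinate process on $\mathbb{W}$ (so, as a map, $W=I_{\mathbb{W}}$, the identity). $\nu$ is a probability measure on $\mathbb{W}$; all filtrations are completed with respect to $\nu$, and $(\mathcal{F}_t)$ is the filtration of $W$. For $p\ge 0$, $L^p_a(\nu,H)$ is the set of $u\in L^p(\nu,H)$ whose density $\dot u$ is $(\mathcal{F}_t)$-adapted ($L^0$: all measurable maps). $\mathcal{D}=\{u\in L^0_a(\nu,H):\dot u \text{ is } d\nu\times dt\text{-a.s. bounded}\}$. For a $\nu$-Brownian motion $\beta$, $\delta_\beta u=\int_0^1\dot u(s)d\beta(s)$, $\rho(-\delta_\beta u)=\exp\left(-\int_0^1\dot u(s)d\beta(s)-\frac12\int_0^1|\dot u(s)|^2ds\right)$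 and $G_p(\nu,\beta)=\{u\in L^p_a(\nu,H):\mathbb{E}_\nu[\rho(-\delta_\beta u)]=1\}$. $U\nu$ denotes the image measure of $\nu$ under $U$. Standing assumption. There are an $\mathbb{R}^n$-valued $\nu$-Brownian motion $\beta$ on $\mathbb{W}$ whose completed canonical filtration equals that of $W$, and a family $(W^u)_{u\in\mathcal{D}}$ of continuous processes on $\mathbb{W}$ (measurable maps $W^u:\mathbb{W}\to\mathbb{W}$) with $W^0=W$; moreover the map $u\mapsto W^u$ is extended to a set $\widetilde{\mathcal{D}}$ such that: (i) $\mathcal{D}\subset\widetilde{\mathcal{D}}\subset G_0(\nu,\beta)$; (ii) for every $u\in\widetilde{\mathcal{D}}$, $W^u$ is $(\mathcal{F}_t)$-adapted; (iii) for every $u\in\widetilde{\mathcal{D}}$, the law of $W^u$ under $\tilde\nu^u$, where $\frac{d\tilde\nu^u}{d\nu}=\rho(-\delta_\beta u)$, equals the law of $W$ under $\nu$; (iv) for every $u\in\widetilde{\mathcal{D}}$, $\beta\circ W^u=\beta+u$ $\nu$-a.s.; (v) for all $u,v\in\widetilde{\mathcal{D}}$ with $v+u\circ W^v\in\widetilde{\mathcal{D}}$, $W^u\circ W^v=W^{v+u\circ W^v}$ $\nu$-a.s. (and this holds for all $u,v\in\mathcal{D}$); (vi) there is a set $\widetilde{\widetilde{\mathcal{D}}}$ with $\widetilde{\mathcal{D}}\subset\widetilde{\widetilde{\mathcal{D}}}\subset L^0_a(\nu,H)$, $\widetilde{\mathcal{D}}=\widetilde{\widetilde{\mathcal{D}}}\cap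 G_0(\nu,\beta)$, and such that for every $u\in\widetilde{\mathcal{D}}$, if the equation $u+v\circ W^u=0$ ($\nu$-a.s.) has a solution $v\in G_0(\nu,\beta)$, then it has a solution $v\in\widetilde{\widetilde{\mathcal{D}}}$. A measurable map $U:\mathbb{W}\to\mathbb{W}$ with $U\nu\sim\nu$ is called $\nu$-a.s. invertible if there is a measurable $V:\mathbb{W}\to\mathbb{W}$ with $V\nu\ll\nu$ and $V\circ U=I_{\mathbb{W}}$ $\nu$-a.s. $\mathcal{D}^i=\{u\in\mathcal{D}: W^u\text{ is }\nu\text{-a.s. invertible}\}$. *)

theory Defs
  imports "HOL-Probability.Probability"
begin

section \<open>Path space and completed filtrations\<close>

text \<open>
  Paths are functions on \<open>{0..1}\<close>, represented extensionally (\<open>undefined\<close> outside \<open>{0..1}\<close>).  The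
  sigma-algebra generated by the evaluations is the Borel sigma-algebra of the uniform norm.
\<close>

definition path_space :: "(real \<Rightarrow> real ^ 'n) measure" where
  "path_space = restrict_space (PiM {0..1} (\<lambda>_. borel)) {w. continuous_on {0..1} w}"

definition path_zero :: "real \<Rightarrow> real ^ 'n" where
  "path_zero = (\<lambda>t\<in>{0..1}. 0)"

definition path_add :: "(real \<Rightarrow> real ^ 'n) \<Rightarrow> (real \<Rightarrow> real ^ 'n) \<Rightarrow> (real \<Rightarrow> real ^ 'n)" where
  "path_add g h = (\<lambda>t\<in>{0..1}. g t + h t)"

definition completed_filtration ::
    "'a measure \<Rightarrow> ('a \<Rightarrow> real \<Rightarrow> real ^ 'n) \<Rightarrow> real \<Rightarrow> 'a measure" where
  "completed_filtration M X t =
     sigma (space M)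
       ({(\<lambda>\<omega>. X \<omega> s) -` B \<inter> space M | s B. s \<in> {0..t} \<and> B \<in> sets borel}
        \<union> null_sets (completion M))"


definition coord_filtration ::
    "(real \<Rightarrow> real ^ 'n) measure \<Rightarrow> real \<Rightarrow> (real \<Rightarrow> real ^ 'n) measure" where
  "coord_filtration \<nu> = completed_filtration \<nu> (\<lambda>w t. w t)"

definition brownian_motion :: "'a measure \<Rightarrow> ('a \<Rightarrow> real \<Rightarrow> real ^ 'n) \<Rightarrow> bool" where
  "brownian_motion M \<beta> \<longleftrightarrow>
     \<beta> \<in> M \<rightarrow>\<^sub>M path_space \<and>
     (AE \<omega> in M. \<beta> \<omega> 0 = 0) \<and>
     (\<forall>s t. 0 \<le> s \<and> s < t \<and> t \<le> 1 \<longrightarrow>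
        prob_space.indep_set M
          (sets (completed_filtration M \<beta> s))
          (sets (vimage_algebra (space M) (\<lambda>\<omega>. \<beta> \<omega> t - \<beta> \<omega> s) borel)) \<and>
        distributed M lborel (\<lambda>\<omega>. \<beta> \<omega> t - \<beta> \<omega> s)
          (\<lambda>x. ennreal (\<Prod>i\<in>UNIV. normal_density 0 (sqrt (t - s)) (x $ i))))"


section \<open>The Cameron-Martin space and adapted drifts\<close>

definition cm_density :: "(real \<Rightarrow> real ^ 'n) \<Rightarrow> (real \<Rightarrow> real ^ 'n) \<Rightarrow> bool" where
  "cm_density h d \<longleftrightarrow>
     h \<in> extensional {0..1} \<and>
     set_borel_measurable lborel {0..1} d \<and>
     set_integrable lborel {0..1} (\<lambda>s. (norm (d s))\<^sup>2) \<and>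
     (\<forall>t\<in>{0..1}. h t = (LINT s:{0..t}|lborel. d s))"

text \<open>The density is unique up to null sets, so the choice below does not affect the norm.\<close>

definition cm_norm :: "(real \<Rightarrow> real ^ 'n) \<Rightarrow> real" where
  "cm_norm h = sqrt (LINT s:{0..1}|lborel. (norm ((SOME d. cm_density h d) s))\<^sup>2)"

text \<open>
  A random element \<open>u\<close> of the Cameron-Martin space is a function from paths to paths; classes
  modulo almost sure equality are represented by all their everywhere Cameron-Martin-valued members.
  Joint measurability of the density expresses that \<open>u\<close> is measurable into the
  (separable) Hilbert space.  Random variables are measurable with respect to the completion of \<open>\<nu>\<close>.
\<close>

definition adapted_density ::
    "(real \<Rightarrow> real ^ 'n) measure \<Rightarrow> ((real \<Rightarrow> real ^ 'n) \<Rightarrow> real \<Rightarrow> real ^ 'n) \<Rightarrow>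
     ((real \<Rightarrow> real ^ 'n) \<Rightarrow> real \<Rightarrow> real ^ 'n) \<Rightarrow> bool" where
  "adapted_density \<nu> u d \<longleftrightarrow>
     (\<lambda>(w, s). d w s) \<in> borel_measurable (completion \<nu> \<Otimes>\<^sub>M restrict_space lborel {0..1}) \<and>
     (\<forall>w\<in>space \<nu>. cm_density (u w) (d w)) \<and>
     (\<forall>t\<in>{0..1}. (\<lambda>w. d w t) \<in> borel_measurable (coord_filtration \<nu> t))"

definition L_a ::
    "real \<Rightarrow> (real \<Rightarrow> real ^ 'n) measure \<Rightarrow> ((real \<Rightarrow> real ^ 'n) \<Rightarrow> real \<Rightarrow> real ^ 'n) set" where
  "L_a p \<nu> = {u. (\<exists>d. adapted_density \<nu> u d) \<and>
                 (p = 0 \<or> integrable (completion \<nu>) (\<lambda>w. cm_norm (u w) powr p))}"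

definition bounded_drifts ::
    "(real \<Rightarrow> real ^ 'n) measure \<Rightarrow> ((real \<Rightarrow> real ^ 'n) \<Rightarrow> real \<Rightarrow> real ^ 'n) set" where
  "bounded_drifts \<nu> = {u. \<exists>d C. adapted_density \<nu> u d \<and>
     (AE (w, s) in completion \<nu> \<Otimes>\<^sub>M restrict_space lborel {0..1}. norm (d w s) \<le> C)}"


section \<open>The stochastic integral\<close>

text \<open>The simple process \<open>\<Sum>i<m. \<xi> i * indicator {\<tau> i<..\<tau> (Suc i)}\<close> with vector coefficients \<open>\<xi> i\<close>.\<close>

definition simple_process ::
    "'a measure \<Rightarrow> (real \<Rightarrow> 'a measure) \<Rightarrow> nat \<Rightarrow> (nat \<Rightarrow> real) \<Rightarrow> (nat \<Rightarrow> 'a \<Rightarrow> real ^ 'n) \<Rightarrow> bool" where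
  "simple_process M F m \<tau> \<xi> \<longleftrightarrow>
     0 \<le> \<tau> 0 \<and> (\<forall>i<m. \<tau> i \<le> \<tau> (Suc i)) \<and> \<tau> m \<le> 1 \<and>
     (\<forall>i<m. \<xi> i \<in> borel_measurable (F (\<tau> i)) \<and> (\<exists>C. \<forall>\<omega>\<in>space M. norm (\<xi> i \<omega>) \<le> C))"

definition simple_value ::
    "nat \<Rightarrow> (nat \<Rightarrow> real) \<Rightarrow> (nat \<Rightarrow> 'a \<Rightarrow> real ^ 'n) \<Rightarrow> 'a \<Rightarrow> real \<Rightarrow> real ^ 'n" where
  "simple_value m \<tau> \<xi> \<omega> s = (\<Sum>i<m. indicator {\<tau> i<..\<tau> (Suc i)} s *\<^sub>R \<xi> i \<omega>)"

definition simple_integral ::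
    "('a \<Rightarrow> real \<Rightarrow> real ^ 'n) \<Rightarrow> nat \<Rightarrow> (nat \<Rightarrow> real) \<Rightarrow> (nat \<Rightarrow> 'a \<Rightarrow> real ^ 'n) \<Rightarrow> 'a \<Rightarrow> real" where
  "simple_integral \<beta> m \<tau> \<xi> \<omega> = (\<Sum>i<m. \<xi> i \<omega> \<bullet> (\<beta> \<omega> (\<tau> (Suc i)) - \<beta> \<omega> (\<tau> i)))"

definition tendsto_in_prob :: "'a measure \<Rightarrow> (nat \<Rightarrow> 'a \<Rightarrow> real) \<Rightarrow> ('a \<Rightarrow> real) \<Rightarrow> bool" where
  "tendsto_in_prob M X Y \<longleftrightarrow>
     (\<forall>\<epsilon>>0. (\<lambda>k. measure M {\<omega>\<in>space M. \<bar>X k \<omega> - Y \<omega>\<bar> > \<epsilon>}) \<longlonglongrightarrow> 0)"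

text \<open>
  \<open>X\<close> is (a version of) the Ito integral over \<open>[0,1]\<close> of the adapted process \<open>d\<close>, whose paths are
  square integrable: the limit in probability of the integrals of simple processes that approximate
  \<open>d\<close> in \<open>L\<^sup>2([0,1])\<close>, in probability.
\<close>

definition is_ito_integral ::
    "'a measure \<Rightarrow> (real \<Rightarrow> 'a measure) \<Rightarrow> ('a \<Rightarrow> real \<Rightarrow> real ^ 'n) \<Rightarrow>
     ('a \<Rightarrow> real \<Rightarrow> real ^ 'n) \<Rightarrow> ('a \<Rightarrow> real) \<Rightarrow> bool" where
  "is_ito_integral M F \<beta> d X \<longleftrightarrow>
     X \<in> borel_measurable M \<and>
     (\<exists>m \<tau> \<xi>. (\<forall>k. simple_process M F (m k) (\<tau> k) (\<xi> k)) \<and>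
        tendsto_in_prob M
          (\<lambda>k \<omega>. LINT s:{0..1}|lborel. (norm (d \<omega> s - simple_value (m k) (\<tau> k) (\<xi> k) \<omega> s))\<^sup>2)
          (\<lambda>\<omega>. 0) \<and>
        tendsto_in_prob M (\<lambda>k. simple_integral \<beta> (m k) (\<tau> k) (\<xi> k)) X)"

text \<open>The divergence is determined up to almost sure equality; a version is chosen.\<close>

definition divergence ::
    "(real \<Rightarrow> real ^ 'n) measure \<Rightarrow> ((real \<Rightarrow> real ^ 'n) \<Rightarrow> real \<Rightarrow> real ^ 'n) \<Rightarrow>
     ((real \<Rightarrow> real ^ 'n) \<Rightarrow> real \<Rightarrow> real ^ 'n) \<Rightarrow> (real \<Rightarrow> real ^ 'n) \<Rightarrow> real" where
  "divergence \<nu> \<beta> u =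
     (SOME X. \<exists>d. adapted_density \<nu> u d \<and>
        is_ito_integral (completion \<nu>) (coord_filtration \<nu>) \<beta> d X)"

definition girsanov_exp ::
    "(real \<Rightarrow> real ^ 'n) measure \<Rightarrow> ((real \<Rightarrow> real ^ 'n) \<Rightarrow> real \<Rightarrow> real ^ 'n) \<Rightarrow>
     ((real \<Rightarrow> real ^ 'n) \<Rightarrow> real \<Rightarrow> real ^ 'n) \<Rightarrow> (real \<Rightarrow> real ^ 'n) \<Rightarrow> real" where
  "girsanov_exp \<nu> \<beta> u w = exp (- divergence \<nu> \<beta> u w - 1 / 2 * (cm_norm (u w))\<^sup>2)"

definition G_drifts ::
    "real \<Rightarrow> (real \<Rightarrow> real ^ 'n) measure \<Rightarrow> ((real \<Rightarrow> real ^ 'n) \<Rightarrow> real \<Rightarrow> real ^ 'n) \<Rightarrow>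
     ((real \<Rightarrow> real ^ 'n) \<Rightarrow> real \<Rightarrow> real ^ 'n) set" where
  "G_drifts p \<nu> \<beta> = {u \<in> L_a p \<nu>. (LINT w|completion \<nu>. girsanov_exp \<nu> \<beta> u w) = 1}"

definition girsanov_measure ::
    "(real \<Rightarrow> real ^ 'n) measure \<Rightarrow> ((real \<Rightarrow> real ^ 'n) \<Rightarrow> real \<Rightarrow> real ^ 'n) \<Rightarrow>
     ((real \<Rightarrow> real ^ 'n) \<Rightarrow> real \<Rightarrow> real ^ 'n) \<Rightarrow> (real \<Rightarrow> real ^ 'n) measure" where
  "girsanov_measure \<nu> \<beta> u = density (completion \<nu>) (\<lambda>w. ennreal (girsanov_exp \<nu> \<beta> u w))"


section \<open>The family of perturbed processes\<close>

definition drift_solves ::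
    "(real \<Rightarrow> real ^ 'n) measure \<Rightarrow> ((real \<Rightarrow> real ^ 'n) \<Rightarrow> real \<Rightarrow> real ^ 'n) \<Rightarrow>
     ((real \<Rightarrow> real ^ 'n) \<Rightarrow> real \<Rightarrow> real ^ 'n) \<Rightarrow> ((real \<Rightarrow> real ^ 'n) \<Rightarrow> real \<Rightarrow> real ^ 'n) \<Rightarrow> bool" where
  "drift_solves \<nu> u U v \<longleftrightarrow> (AE w in completion \<nu>. path_add (u w) (v (U w)) = path_zero)"

text \<open>
  \<open>Dt\<close> and \<open>Dtt\<close> are the sets written as D with one and two tildes.  Processes are identified when
  they agree almost surely, so \<open>W\<^sup>0 = W\<close> is required almost surely.
\<close>

locale perturbation_family =
  fixes \<nu> :: "(real \<Rightarrow> real ^ 'n) measure"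
    and \<beta> :: "(real \<Rightarrow> real ^ 'n) \<Rightarrow> real \<Rightarrow> real ^ 'n"
    and W :: "((real \<Rightarrow> real ^ 'n) \<Rightarrow> real \<Rightarrow> real ^ 'n) \<Rightarrow> (real \<Rightarrow> real ^ 'n) \<Rightarrow> real \<Rightarrow> real ^ 'n"
    and Dt :: "((real \<Rightarrow> real ^ 'n) \<Rightarrow> real \<Rightarrow> real ^ 'n) set"
  assumes prob: "prob_space \<nu>"
    and sets_nu: "sets \<nu> = sets path_space"
    and bm: "brownian_motion (completion \<nu>) \<beta>"
    and bm_filtration:
      "\<forall>t\<in>{0..1}. sets (completed_filtration \<nu> \<beta> t) = sets (coord_filtration \<nu> t)"
    and W_measurable: "\<forall>u\<in>Dt. W u \<in> completion \<nu> \<rightarrow>\<^sub>M path_space"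
    and W_zero: "AE w in completion \<nu>. W (\<lambda>_. path_zero) w = w"
    and D_subset: "bounded_drifts \<nu> \<subseteq> Dt"
    and Dt_subset: "Dt \<subseteq> G_drifts 0 \<nu> \<beta>"
    and W_adapted:
      "\<forall>u\<in>Dt. \<forall>t\<in>{0..1}. (\<lambda>w. W u w t) \<in> borel_measurable (coord_filtration \<nu> t)"
    and W_law:
      "\<forall>u\<in>Dt. distr (girsanov_measure \<nu> \<beta> u) path_space (W u) =
               distr (completion \<nu>) path_space (\<lambda>w. w)"
    and beta_W: "\<forall>u\<in>Dt. AE w in completion \<nu>. \<beta> (W u w) = path_add (\<beta> w) (u w)"
    and W_comp:
      "\<forall>u\<in>Dt. \<forall>v\<in>Dt. (\<lambda>w. path_add (v w) (u (W v w))) \<in> Dt \<longrightarrow>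
         (AE w in completion \<nu>. W u (W v w) = W (\<lambda>w. path_add (v w) (u (W v w))) w)"
    and W_comp_bounded:
      "\<forall>u\<in>bounded_drifts \<nu>. \<forall>v\<in>bounded_drifts \<nu>.
         (AE w in completion \<nu>. W u (W v w) = W (\<lambda>w. path_add (v w) (u (W v w))) w)"
    and solutions:
      "\<exists>Dtt. Dt \<subseteq> Dtt \<and> Dtt \<subseteq> L_a 0 \<nu> \<and> Dt = Dtt \<inter> G_drifts 0 \<nu> \<beta> \<and>
         (\<forall>u\<in>Dt. (\<exists>v\<in>G_drifts 0 \<nu> \<beta>. drift_solves \<nu> u (W u) v) \<longrightarrow>
                  (\<exists>v\<in>Dtt. drift_solves \<nu> u (W u) v))"

definition as_invertible ::
    "(real \<Rightarrow> real ^ 'n) measure \<Rightarrow> ((real \<Rightarrow> real ^ 'n) \<Rightarrow> real \<Rightarrow> real ^ 'n) \<Rightarrow> bool" where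
  "as_invertible \<nu> U \<longleftrightarrow>
     U \<in> completion \<nu> \<rightarrow>\<^sub>M path_space \<and>
     absolutely_continuous \<nu> (distr (completion \<nu>) path_space U) \<and>
     absolutely_continuous (distr (completion \<nu>) path_space U) \<nu> \<and>
     (\<exists>V. V \<in> completion \<nu> \<rightarrow>\<^sub>M path_space \<and>
          absolutely_continuous \<nu> (distr (completion \<nu>) path_space V) \<and>
          (AE w in completion \<nu>. V (U w) = w))"

definition invertible_drifts ::
    "(real \<Rightarrow> real ^ 'n) measure \<Rightarrow>
     (((real \<Rightarrow> real ^ 'n) \<Rightarrow> real \<Rightarrow> real ^ 'n) \<Rightarrow> (real \<Rightarrow> real ^ 'n) \<Rightarrow> real \<Rightarrow> real ^ 'n) \<Rightarrow>
     ((real \<Rightarrow> real ^ 'n) \<Rightarrow> real \<Rightarrow> real ^ 'n) set" where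
  "invertible_drifts \<nu> W = {u \<in> bounded_drifts \<nu>. as_invertible \<nu> (W u)}"

text \<open>
  Expectation with values in the extended reals, positive part minus negative part
  (\<open>ennreal\<close> maps negative reals to 0).  It is meaningful unless both parts are infinite.
\<close>

definition ereal_expectation :: "'a measure \<Rightarrow> ('a \<Rightarrow> real) \<Rightarrow> ereal" where
  "ereal_expectation M X =
     enn2ereal (\<integral>\<^sup>+ \<omega>. ennreal (X \<omega>) \<partial>M) - enn2ereal (\<integral>\<^sup>+ \<omega>. ennreal (- X \<omega>) \<partial>M)"

end

theory Submission
  imports Defs
begin

text \<open>
  The infimum over \<open>Dt \<inter> L_a 2 \<nu>\<close> is at most the one over invertible drifts because bounded drifts lie in
  \<open>L_a 2 \<nu>\<close>.  For the converse, \<open>f\<close> is a functional of \<open>\<beta>\<close> up to null sets, \<open>\<beta> \<circ> W u = \<beta> + u\<close>, and \<open>W u\<close>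
  maps \<open>\<nu>\<close> to an absolutely continuous measure, so it suffices to bound
  \<open>E[h(\<beta> + u)] \<le> ln E[exp (h(\<beta>))] + E[|u|^2] / 2\<close> for bounded measurable \<open>h\<close>.  By density and absolute continuity one
  may take \<open>h\<close> continuous for pointwise convergence of paths.  Then \<open>\<beta>\<close> is sampled on the grid of mesh
  \<open>1/N\<close> and \<open>u\<close> on the grid delayed by \<open>1/N\<close>, so that the shifts are predictable and only the
  entropy bound for Gaussian shifts is needed, one increment at a time.  No stochastic integral enters:
  of the Girsanov exponential only positivity, and measurability, are used.
\<close>

section \<open>Gaussian shifts\<close>

text \<open>With h = -f, the bound is a Gibbs-type inequality: a change of measure followed by
  Jensen's inequality trades the expectation of the shifted functional for the log-Laplace transform
  of the unshifted one, at the price of a relative entropy. For a shift of the Gaussian law of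
  covariance \<delta> times the identity by a, this entropy is |a|^2 / (2 \<delta>). With \<delta> =
  1/N the entropies along the grid add up to N/2 times a sum of squared increments, which
  Cauchy-Schwarz bounds by half the energy of u for every N; hence the constant 1/2 survives the
  limit. Discretisation puts finitely many explicit Gaussian densities in its place. The delay is
  forced: the increment of u over a cell may depend on the increment of \<beta> over the same cell,
  while integrating out one increment requires the shift to be independent of it. All bounds are
  proved for bounded functionals, so -f is clamped to [-n, n]. Removing the clamp requires
  integrability of f along W u, which is derived from the clamped bounds themselves.\<close>

lemma (in prob_space) exp_expectation_le:
  fixes X :: "'a \<Rightarrow> real"
  assumes "integrable M X" and "integrable M (\<lambda>x. exp (X x))"
  shows "exp (expectation X) \<le> expectation (\<lambda>x. exp (X x))"
  by (rule jensens_inequality[where I=UNIV and q=exp]) (use assms convex_on_exp[of 1] in auto)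

text \<open>The density is written exactly as in \<open>brownian_motion\<close>, so that the law of
  an increment over a time step \<delta> is this measure by unfolding. Its total mass 1 is read off
  from such a law.\<close>

definition gaussian :: "real \<Rightarrow> (real ^ 'n) measure" where
  "gaussian \<delta> = density lborel (\<lambda>x. ennreal (\<Prod>i\<in>UNIV. normal_density 0 (sqrt \<delta>) (x $ i)))"

lemma sets_gaussian [simp, measurable_cong]: "sets (gaussian \<delta>) = sets borel"
  by (simp add: gaussian_def)

lemma space_gaussian [simp]: "space (gaussian \<delta>) = UNIV"
  by (simp add: gaussian_def)

lemma gaussian_density_measurable [measurable]:
  "(\<lambda>x::real^'n. \<Prod>i\<in>UNIV. normal_density 0 \<sigma> (x $ i)) \<in> borel_measurable borel"
  by (intro borel_measurable_prod) measurable

text \<open>Expanding the square in each coordinate; the product over coordinates assembles the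
  exponents into an inner product and a norm.\<close>

lemma gaussian_density_shift:
  fixes x a :: "real ^ 'n"
  assumes "\<delta> > 0"
  shows "(\<Prod>i\<in>UNIV. normal_density 0 (sqrt \<delta>) ((a + x) $ i)) =
    (\<Prod>i\<in>UNIV. normal_density 0 (sqrt \<delta>) (x $ i)) * exp (- (a \<bullet> x) / \<delta> - (norm a)\<^sup>2 / (2 * \<delta>))"
proof -
  have "normal_density 0 (sqrt \<delta>) (a $ i + x $ i) =
      normal_density 0 (sqrt \<delta>) (x $ i) * exp (- (a $ i * x $ i) / \<delta> - (a $ i)\<^sup>2 / (2 * \<delta>))" for i
    using assms by (simp add: normal_density_def power2_eq_square field_simps flip: exp_add)
  moreover have "(\<Sum>i\<in>UNIV. - (a $ i * x $ i) / \<delta> - (a $ i)\<^sup>2 / (2 * \<delta>)) =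
      - (a \<bullet> x) / \<delta> - (norm a)\<^sup>2 / (2 * \<delta>)"
    unfolding power2_norm_eq_inner
    by (simp add: inner_vec_def power2_eq_square sum_subtractf sum_negf sum_divide_distrib)
  ultimately show ?thesis
    by (simp add: prod.distrib flip: exp_sum)
qed

lemma integral_gaussian:
  fixes h :: "real ^ 'n \<Rightarrow> real"
  assumes [measurable]: "h \<in> borel_measurable borel"
  shows "(\<integral>x. h x \<partial>gaussian \<delta>) = (\<integral>x. (\<Prod>i\<in>UNIV. normal_density 0 (sqrt \<delta>) (x $ i)) * h x \<partial>lborel)"
    and "integrable (gaussian \<delta>) h \<longleftrightarrow>
      integrable lborel (\<lambda>x. (\<Prod>i\<in>UNIV. normal_density 0 (sqrt \<delta>) (x $ i)) * h x)"
proof -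
  have nn: "0 \<le> (\<Prod>i\<in>UNIV. normal_density 0 (sqrt \<delta>) (x $ i))" for x :: "real ^ 'n"
    by (intro prod_nonneg) auto
  show "(\<integral>x. h x \<partial>gaussian \<delta>) = (\<integral>x. (\<Prod>i\<in>UNIV. normal_density 0 (sqrt \<delta>) (x $ i)) * h x \<partial>lborel)"
    "integrable (gaussian \<delta>) h \<longleftrightarrow>
      integrable lborel (\<lambda>x. (\<Prod>i\<in>UNIV. normal_density 0 (sqrt \<delta>) (x $ i)) * h x)"
    unfolding gaussian_def using nn by (simp_all add: integral_density integrable_density)
qed

text \<open>Finite-dimensional Cameron-Martin formula: Lebesgue measure is translation invariant,
  and the exponential is the quotient of the translated density by the original one.\<close>

lemma gaussian_cameron_martin:
  fixes h :: "real ^ 'n \<Rightarrow> real"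
  assumes \<delta>: "\<delta> > 0" and [measurable]: "h \<in> borel_measurable borel" and "integrable (gaussian \<delta>) h"
  shows "integrable (gaussian \<delta>) (\<lambda>x. exp (- (a \<bullet> x) / \<delta> - (norm a)\<^sup>2 / (2 * \<delta>)) * h (a + x))" (is ?I)
    and "(\<integral>x. exp (- (a \<bullet> x) / \<delta> - (norm a)\<^sup>2 / (2 * \<delta>)) * h (a + x) \<partial>gaussian \<delta>) =
      (\<integral>x. h x \<partial>gaussian \<delta>)" (is ?E)
proof -
  define p where "p x = (\<Prod>i\<in>UNIV. normal_density 0 (sqrt \<delta>) (x $ i))" for x :: "real ^ 'n"
  have [measurable]: "p \<in> borel_measurable borel" unfolding p_def by measurable
  have shift: "p x * (exp (- (a \<bullet> x) / \<delta> - (norm a)\<^sup>2 / (2 * \<delta>)) * h (a + x)) = p (a + x) * h (a + x)" for x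
    using gaussian_density_shift[OF \<delta>, of a x] by (simp add: p_def)
  have "integrable lborel (\<lambda>x. p x * h x)"
    using assms by (simp add: integral_gaussian p_def)
  then have "integrable (distr lborel borel ((+) a)) (\<lambda>x. p x * h x)"
    by (simp add: lborel_distr_plus)
  then show ?I
    by (subst (asm) integrable_distr_eq) (simp_all add: integral_gaussian flip: p_def shift)
  have "(\<integral>x. p x * h x \<partial>lborel) = (\<integral>x. p x * h x \<partial>distr lborel borel ((+) a))"
    by (simp add: lborel_distr_plus)
  also have "\<dots> = (\<integral>x. p (a + x) * h (a + x) \<partial>lborel)"
    by (subst integral_distr) simp_all
  finally show ?E
    by (simp add: integral_gaussian flip: p_def shift)
qed

text \<open>Serves to show that odd functions, in particular the truncated linear exponent below,
  have mean zero.\<close>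

lemma gaussian_symmetric:
  fixes h :: "real ^ 'n \<Rightarrow> real"
  assumes [measurable]: "h \<in> borel_measurable borel"
  shows "(\<integral>x. h (- x) \<partial>gaussian \<delta>) = (\<integral>x. h x \<partial>gaussian \<delta>)"
proof -
  have "distr lborel borel uminus = (lborel :: (real ^ 'n) measure)"
    by (subst (2) lborel_affine[of "-1" 0]) (simp_all add: density_1)
  moreover have "normal_density 0 \<sigma> (- y) = normal_density 0 \<sigma> y" for \<sigma> y
    by (simp add: normal_density_def)
  ultimately show ?thesis
    using integral_distr[of "uminus :: real ^ 'n \<Rightarrow> _" lborel borel
        "\<lambda>x. (\<Prod>i\<in>UNIV. normal_density 0 (sqrt \<delta>) (x $ i)) * h x"]
    by (simp add: integral_gaussian)
qed

text \<open>The linear exponent is truncated, so that no moments of the Gaussian law are needed.\<close>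

lemma gaussian_shift_entropy:
  fixes h :: "real ^ 'n \<Rightarrow> real"
  assumes \<delta>: "\<delta> > 0" and prob: "prob_space (gaussian \<delta> :: (real ^ 'n) measure)"
    and h [measurable]: "h \<in> borel_measurable borel" and C: "\<And>x. \<bar>h x\<bar> \<le> C"
  shows "(\<integral>x. h (a + x) \<partial>gaussian \<delta>) \<le> ln (\<integral>x. exp (h x) \<partial>gaussian \<delta>) + (norm a)\<^sup>2 / (2 * \<delta>)"
proof -
  interpret prob_space "gaussian \<delta> :: (real ^ 'n) measure" by fact
  define z where "z x = - (a \<bullet> x) / \<delta>" for x
  have [measurable]: "z \<in> borel_measurable borel" unfolding z_def by measurable
  \<comment> \<open>Clamping symmetrically keeps \<open>c k\<close> odd like \<open>z\<close>, hence
    of mean zero: adding it to the exponent leaves the left side of Jensen's inequality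
    unchanged.\<close>
  define c where "c k x = max (- real k) (min (real k) (z x))" for k x
  have [measurable]: "c k \<in> borel_measurable borel" for k unfolding c_def by measurable
  have c_bound: "\<bar>c k x\<bar> \<le> real k" for k x by (auto simp: c_def)
  define S where "S = exp ((norm a)\<^sup>2 / (2 * \<delta>)) * (\<integral>x. exp (h x) \<partial>gaussian \<delta>)"
  have int_h: "integrable (gaussian \<delta>) (\<lambda>x. exp (h x))"
    by (intro integrable_const_bound[where B="exp C"] AE_I2) (use C in \<open>auto simp: abs_le_iff\<close>)
  \<comment> \<open>\<open>z\<close> is the linear part of the Cameron-Martin exponent. The missing
    quadratic part is the constant factor in \<open>S\<close> and becomes the entropy term once
    \<open>ln\<close> is taken.\<close>
  have eq: "exp (h (a + x) + z x) = exp ((norm a)\<^sup>2 / (2 * \<delta>)) *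
      (exp (- (a \<bullet> x) / \<delta> - (norm a)\<^sup>2 / (2 * \<delta>)) * exp (h (a + x)))" for x
    by (simp add: z_def flip: exp_add)
  note cm = gaussian_cameron_martin[OF \<delta> _ int_h, of a]
  have int_z: "integrable (gaussian \<delta>) (\<lambda>x. exp (h (a + x) + z x))"
    unfolding eq by (intro integrable_mult_right cm) simp
  have S: "(\<integral>x. exp (h (a + x) + z x) \<partial>gaussian \<delta>) = S"
    unfolding eq S_def integral_mult_right_zero by (subst cm(2)) simp_all
  have mean: "(\<integral>x. c k x \<partial>gaussian \<delta>) = 0" for k
  proof -
    have "c k (- x) = - c k x" for x
      by (auto simp: c_def z_def min_def max_def)
    then show ?thesis
      using gaussian_symmetric[of "c k" \<delta>] by simp
  qed
  \<comment> \<open>The clamp lies above \<open>z\<close> only where \<open>z\<close> is below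
    \<open>- real k\<close>. There the exponent is at most \<open>C - real k\<close>, which is the
    source of the error term.\<close>
  have "exp (\<integral>x. h (a + x) \<partial>gaussian \<delta>) \<le> S + exp (C - real k)" for k
  proof -
    have int1: "integrable (gaussian \<delta>) (\<lambda>x. h (a + x))"
      by (intro integrable_const_bound[where B=C] AE_I2) (use C in auto)
    have int2: "integrable (gaussian \<delta>) (c k)"
      by (intro integrable_const_bound[where B="real k"] AE_I2) (use c_bound in auto)
    have int3: "integrable (gaussian \<delta>) (\<lambda>x. exp (h (a + x) + c k x))"
    proof (intro integrable_const_bound[where B="exp (C + real k)"] AE_I2)
      fix x show "norm (exp (h (a + x) + c k x)) \<le> exp (C + real k)"
        using C[of "a + x"] c_bound[of k x] by simp
    qed simp
    have "exp (\<integral>x. h (a + x) \<partial>gaussian \<delta>) = exp (\<integral>x. h (a + x) + c k x \<partial>gaussian \<delta>)"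
      using int1 int2 by (simp add: mean)
    also have "\<dots> \<le> (\<integral>x. exp (h (a + x) + c k x) \<partial>gaussian \<delta>)"
      using int1 int2 int3 by (intro exp_expectation_le) auto
    also have "\<dots> \<le> (\<integral>x. exp (h (a + x) + z x) + exp (C - real k) \<partial>gaussian \<delta>)"
    proof (intro integral_mono int3)
      fix x
      show "exp (h (a + x) + c k x) \<le> exp (h (a + x) + z x) + exp (C - real k)"
      proof (cases "z x \<le> - real k")
        case True
        then have "c k x = - real k" by (auto simp: c_def)
        then have "exp (h (a + x) + c k x) \<le> exp (C - real k)" using C[of "a + x"] by simp
        then show ?thesis by (simp add: add_increasing)
      next
        case False
        then have "c k x \<le> z x" by (auto simp: c_def)
        then have "exp (h (a + x) + c k x) \<le> exp (h (a + x) + z x)" by simp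
        then show ?thesis by (simp add: add_increasing2)
      qed
    qed (use int_z in simp)
    also have "\<dots> = S + exp (C - real k)"
      using int_z S prob_space by simp
    finally show ?thesis .
  qed
  moreover have "(\<lambda>k. S + exp (C - real k)) \<longlonglongrightarrow> S + 0"
  proof (intro tendsto_intros)
    have "filterlim (\<lambda>k. - C + real k) at_top sequentially"
      by (intro filterlim_tendsto_add_at_top[OF tendsto_const] filterlim_real_sequentially)
    from filterlim_compose[OF exp_at_bot filterlim_compose[OF filterlim_uminus_at_bot_at_top this]]
    show "(\<lambda>k. exp (C - real k)) \<longlonglongrightarrow> 0" by simp
  qed
  ultimately have "exp (\<integral>x. h (a + x) \<partial>gaussian \<delta>) \<le> S"
    by (intro LIMSEQ_le_const[of "\<lambda>k. S + exp (C - real k)"]) auto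
  moreover have "exp (- C) \<le> (\<integral>x. exp (h x) \<partial>gaussian \<delta>)"
  proof -
    have "(\<integral>x. exp (- C) \<partial>(gaussian \<delta> :: (real ^ 'n) measure)) \<le> (\<integral>x. exp (h x) \<partial>gaussian \<delta>)"
      using int_h C by (intro integral_mono) (auto simp: abs_le_iff minus_le_iff)
    then show ?thesis using prob_space by simp
  qed
  then have pos: "(\<integral>x. exp (h x) \<partial>gaussian \<delta>) > 0"
    by (rule less_le_trans[OF exp_gt_zero])
  ultimately have "(\<integral>x. h (a + x) \<partial>gaussian \<delta>) \<le> ln S"
    by (simp add: ln_ge_iff S_def)
  also have "ln S = ln (\<integral>x. exp (h x) \<partial>gaussian \<delta>) + (norm a)\<^sup>2 / (2 * \<delta>)"
    using pos by (simp add: S_def ln_mult)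
  finally show ?thesis .
qed


section \<open>Predictable shifts of independent Gaussian increments\<close>

text \<open>A product law is determined on rectangles, where the two preimages lie in the two
  independent sigma-algebras. Since \<open>Z\<close> is any map measurable for \<open>G\<close>, the
  whole past can be paired with one increment.\<close>

lemma (in prob_space) distr_indep_pair:
  assumes G: "subalgebra M G"
    and indep: "indep_set (sets G) (sets (vimage_algebra (space M) X borel))"
    and X: "X \<in> borel_measurable M" and Z: "Z \<in> G \<rightarrow>\<^sub>M S"
  shows "distr M S Z \<Otimes>\<^sub>M distr M borel X = distr M (S \<Otimes>\<^sub>M borel) (\<lambda>\<omega>. (Z \<omega>, X \<omega>))"
proof (rule pair_measure_eqI)
  have ZM: "Z \<in> M \<rightarrow>\<^sub>M S"
    using measurable_from_subalg[OF G Z] .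
  show "sigma_finite_measure (distr M S Z)" "sigma_finite_measure (distr M borel X)"
    using prob_space_distr[OF ZM] prob_space_distr[OF X]
    by (auto intro: prob_space_imp_sigma_finite)
  show "sets (distr M S Z \<Otimes>\<^sub>M distr M borel X) = sets (distr M (S \<Otimes>\<^sub>M borel) (\<lambda>\<omega>. (Z \<omega>, X \<omega>)))"
    by (simp cong: sets_pair_measure_cong)
  fix A B assume "A \<in> sets (distr M S Z)" "B \<in> sets (distr M borel X)"
  then have AB: "A \<in> sets S" "B \<in> sets borel" by auto
  have *: "(\<lambda>\<omega>. (Z \<omega>, X \<omega>)) -` (A \<times> B) \<inter> space M = (Z -` A \<inter> space M) \<inter> (X -` B \<inter> space M)" by auto
  have "prob ((Z -` A \<inter> space M) \<inter> (X -` B \<inter> space M)) = prob (Z -` A \<inter> space M) * prob (X -` B \<inter> space M)"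
  proof (rule indep_setD[OF indep])
    show "Z -` A \<inter> space M \<in> sets G"
      using measurable_sets[OF Z AB(1)] G by (simp add: subalgebra_def)
    show "X -` B \<inter> space M \<in> sets (vimage_algebra (space M) X borel)"
      using AB(2) by (rule in_vimage_algebra)
  qed
  then show "emeasure (distr M S Z) A * emeasure (distr M borel X) B =
      emeasure (distr M (S \<Otimes>\<^sub>M borel) (\<lambda>\<omega>. (Z \<omega>, X \<omega>))) (A \<times> B)"
    using AB ZM X by (simp add: emeasure_distr * emeasure_eq_measure flip: ennreal_mult)
qed

text \<open>Freezing: Fubini on the product law integrates out \<open>X\<close> with
  \<open>Z\<close> held fixed, which does the work of a conditional expectation given
  \<open>G\<close>.\<close>

lemma (in prob_space) expectation_indep_split:
  fixes F :: "'s \<Rightarrow> 'c::topological_space \<Rightarrow> real"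
  assumes G: "subalgebra M G"
    and indep: "indep_set (sets G) (sets (vimage_algebra (space M) X borel))"
    and X: "X \<in> borel_measurable M" and Z: "Z \<in> G \<rightarrow>\<^sub>M S"
    and F: "(\<lambda>(y, x). F y x) \<in> borel_measurable (S \<Otimes>\<^sub>M borel)"
    and C: "\<And>y x. \<bar>F y x\<bar> \<le> C"
  shows "integrable M (\<lambda>\<omega>. \<integral>x. F (Z \<omega>) x \<partial>distr M borel X)"
    and "expectation (\<lambda>\<omega>. F (Z \<omega>) (X \<omega>)) =
      expectation (\<lambda>\<omega>. \<integral>x. F (Z \<omega>) x \<partial>distr M borel X)"
proof -
  have ZM: "Z \<in> M \<rightarrow>\<^sub>M S"
    using measurable_from_subalg[OF G Z] .
  interpret DX: prob_space "distr M borel X" by (rule prob_space_distr) fact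
  interpret DZ: prob_space "distr M S Z" by (rule prob_space_distr) fact
  interpret P: pair_prob_space "distr M S Z" "distr M borel X" ..
  have F': "(\<lambda>(y, x). F y x) \<in> borel_measurable (distr M S Z \<Otimes>\<^sub>M distr M borel X)"
    using F by (simp cong: measurable_cong_sets sets_pair_measure_cong)
  have F'': "(\<lambda>(y, x). F y x) \<in> borel_measurable (S \<Otimes>\<^sub>M distr M borel X)"
    using F by (simp cong: measurable_cong_sets sets_pair_measure_cong)
  have inner: "(\<lambda>y. \<integral>x. F y x \<partial>distr M borel X) \<in> borel_measurable S"
    by (rule DX.borel_measurable_lebesgue_integral) (rule F'')
  have Fy: "F y \<in> borel_measurable (distr M borel X)" if "y \<in> space S" for y
    using measurable_Pair2[OF F that] by simp
  show "integrable M (\<lambda>\<omega>. \<integral>x. F (Z \<omega>) x \<partial>distr M borel X)"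
  proof (intro integrable_const_bound[where B=C] AE_I2)
    fix \<omega> assume "\<omega> \<in> space M"
    then have "F (Z \<omega>) \<in> borel_measurable (distr M borel X)"
      using Fy measurable_space[OF ZM] by blast
    then have "integrable (distr M borel X) (F (Z \<omega>))"
      by (intro DX.integrable_const_bound[where B=C] AE_I2) (use C in auto)
    then have "norm (\<integral>x. F (Z \<omega>) x \<partial>distr M borel X) \<le> (\<integral>x. norm (F (Z \<omega>) x) \<partial>distr M borel X)"
      by (intro integral_norm_bound)
    also have "\<dots> \<le> (\<integral>x. C \<partial>distr M borel X)"
      using \<open>integrable (distr M borel X) (F (Z \<omega>))\<close> C by (intro integral_mono) auto
    finally show "norm (\<integral>x. F (Z \<omega>) x \<partial>distr M borel X) \<le> C" using DX.prob_space by simp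
  qed (use measurable_compose[OF ZM inner] in simp)
  have int: "integrable (distr M S Z \<Otimes>\<^sub>M distr M borel X) (\<lambda>(y, x). F y x)"
    by (intro P.integrable_const_bound[where B=C] AE_I2 F') (use C in auto)
  have "expectation (\<lambda>\<omega>. F (Z \<omega>) (X \<omega>)) =
      (\<integral>p. (\<lambda>(y, x). F y x) p \<partial>distr M (S \<Otimes>\<^sub>M borel) (\<lambda>\<omega>. (Z \<omega>, X \<omega>)))"
    using measurable_Pair[OF ZM X] F by (subst integral_distr) auto
  also have "\<dots> = (\<integral>y. \<integral>x. F y x \<partial>distr M borel X \<partial>distr M S Z)"
    using P.integral_fst'[OF int] by (simp add: distr_indep_pair[OF G indep X Z])
  also have "\<dots> = expectation (\<lambda>\<omega>. \<integral>x. F (Z \<omega>) x \<partial>distr M borel X)"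
    using inner ZM by (subst integral_distr) auto
  finally show "expectation (\<lambda>\<omega>. F (Z \<omega>) (X \<omega>)) =
      expectation (\<lambda>\<omega>. \<integral>x. F (Z \<omega>) x \<partial>distr M borel X)" .
qed

abbreviation (input) seq_borel :: "(nat \<Rightarrow> 'b::topological_space) measure" where
  "seq_borel \<equiv> PiM UNIV (\<lambda>_. borel)"

lemma measurable_seq_upd:
  "(\<lambda>(y, x). y(m := x)) \<in> seq_borel \<Otimes>\<^sub>M borel \<rightarrow>\<^sub>M (seq_borel :: (nat \<Rightarrow> 'b::topological_space) measure)"
  by (rule measurable_PiM_single') (auto simp: space_PiM split_beta')

lemma measurable_seq_truncate:
  assumes "\<And>j. j < m \<Longrightarrow> X j \<in> borel_measurable M"
  shows "(\<lambda>\<omega> j. if j < m then X j \<omega> else (0::'b::{topological_space, zero})) \<in> M \<rightarrow>\<^sub>M seq_borel"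
proof (rule measurable_PiM_single')
  show "(\<lambda>\<omega>. if j < m then X j \<omega> else 0) \<in> borel_measurable M" for j
    using assms[of j] by (cases "j < m") auto
qed (auto simp: space_PiM)

lemma (in prob_space) exp_bound_integral:
  fixes h :: "'a \<Rightarrow> real"
  assumes [measurable]: "h \<in> borel_measurable M" and C: "\<And>x. \<bar>h x\<bar> \<le> C"
  shows "integrable M (\<lambda>x. exp (h x))"
    and "exp (- C) \<le> expectation (\<lambda>x. exp (h x))" and "expectation (\<lambda>x. exp (h x)) \<le> exp C"
proof -
  have bnd: "exp (- C) \<le> exp (h x)" "exp (h x) \<le> exp C" for x
    using C[of x] by (auto simp: abs_le_iff)
  show int: "integrable M (\<lambda>x. exp (h x))"
    by (intro integrable_const_bound[where B="exp C"] AE_I2) (use bnd in auto)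
  show "exp (- C) \<le> expectation (\<lambda>x. exp (h x))"
    using integral_mono[OF integrable_const int, of "exp (- C)"] bnd by (simp add: prob_space)
  show "expectation (\<lambda>x. exp (h x)) \<le> exp C"
    using integral_mono[OF int integrable_const, of "exp C"] bnd by (simp add: prob_space)
qed

text \<open>
  The exponential moment is integrated out one increment at a time, starting with the last one;
  each step costs the relative entropy of a Gaussian shift.
\<close>

lemma (in prob_space) discrete_variational_bound:
  fixes \<xi> a :: "nat \<Rightarrow> 'a \<Rightarrow> real ^ 'n" and F :: "(nat \<Rightarrow> real ^ 'n) \<Rightarrow> real"
  assumes \<delta>: "\<delta> > 0"
    and G: "\<And>i. i < N \<Longrightarrow> subalgebra M (G i)"
    and \<xi>G: "\<And>i j. j < i \<Longrightarrow> i < N \<Longrightarrow> \<xi> j \<in> borel_measurable (G i)"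
    and aG: "\<And>i j. j \<le> i \<Longrightarrow> i < N \<Longrightarrow> a j \<in> borel_measurable (G i)"
    and \<xi>: "\<And>i. i < N \<Longrightarrow> \<xi> i \<in> borel_measurable M"
    and indep: "\<And>i. i < N \<Longrightarrow> indep_set (sets (G i)) (sets (vimage_algebra (space M) (\<xi> i) borel))"
    and law: "\<And>i. i < N \<Longrightarrow> distr M borel (\<xi> i) = gaussian \<delta>"
    and int_a: "\<And>i. i < N \<Longrightarrow> integrable M (\<lambda>\<omega>. (norm (a i \<omega>))\<^sup>2)"
    and "F \<in> borel_measurable seq_borel" and "\<And>y. \<bar>F y\<bar> \<le> C" and "m \<le> N"
  shows "expectation (\<lambda>\<omega>. F (\<lambda>j. if j < m then a j \<omega> + \<xi> j \<omega> else 0)) \<le>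
    ln (expectation (\<lambda>\<omega>. exp (F (\<lambda>j. if j < m then \<xi> j \<omega> else 0)))) +
    (\<Sum>i<m. expectation (\<lambda>\<omega>. (norm (a i \<omega>))\<^sup>2) / (2 * \<delta>))"
  using assms(9-)
proof (induction m arbitrary: F)
  case 0
  then show ?case by (simp add: prob_space)
next
  case (Suc m)
  note [measurable] = Suc.prems(1)
  have m: "m < N" using Suc.prems by simp
  have prob: "prob_space (gaussian \<delta> :: (real ^ 'n) measure)"
    using prob_space_distr[OF \<xi>[OF m]] law[OF m] by simp
  then interpret g: prob_space "gaussian \<delta> :: (real ^ 'n) measure" .
  \<comment> \<open>The last coordinate is integrated out under the unshifted law. With the
    logarithm, \<open>F'\<close> again has the bound \<open>C\<close> and \<open>exp (F' y)\<close>
    is the partial exponential moment, so the induction hypothesis applies to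
    \<open>F'\<close>.\<close>
  define F' where "F' y = ln (\<integral>x. exp (F (y(m := x))) \<partial>gaussian \<delta>)" for y
  have Fupd: "(\<lambda>(y, x). F (y(m := x))) \<in> borel_measurable (seq_borel \<Otimes>\<^sub>M borel)"
    using measurable_compose[OF measurable_seq_upd[of m] Suc.prems(1)]
    by (simp add: split_beta' del: fun_upd_apply)
  have Fupd1: "(\<lambda>x. F (y(m := x))) \<in> borel_measurable borel" for y
    using measurable_Pair2[OF Fupd, of y] by (simp add: space_PiM)
  have expF: "exp (F' y) = (\<integral>x. exp (F (y(m := x))) \<partial>gaussian \<delta>)"
    and F'_bound: "\<bar>F' y\<bar> \<le> C" for y
  proof -
    have meas: "(\<lambda>x. F (y(m := x))) \<in> borel_measurable (gaussian \<delta>)" using Fupd1 by simp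
    note bnd = g.exp_bound_integral[OF meas, of C, OF Suc.prems(2)]
    have pos: "(\<integral>x. exp (F (y(m := x))) \<partial>gaussian \<delta>) > 0"
      using bnd(2) by (rule less_le_trans[OF exp_gt_zero])
    then show *: "exp (F' y) = (\<integral>x. exp (F (y(m := x))) \<partial>gaussian \<delta>)" by (simp add: F'_def)
    show "\<bar>F' y\<bar> \<le> C" using bnd(2,3) unfolding *[symmetric] by auto
  qed
  have F'_meas [measurable]: "F' \<in> borel_measurable seq_borel"
  proof -
    have "(\<lambda>(y, x). exp (F (y(m := x)))) \<in> borel_measurable (seq_borel \<Otimes>\<^sub>M gaussian \<delta>)"
      using measurable_compose[OF Fupd borel_measurable_exp]
      by (simp add: split_beta' del: fun_upd_apply cong: measurable_cong_sets sets_pair_measure_cong)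
    then show ?thesis
      unfolding F'_def
      by (intro borel_measurable_ln g.borel_measurable_lebesgue_integral) simp
  qed
  \<comment> \<open>Filling with zeros from index \<open>m\<close> on keeps all stages of the
    induction on the same sequence space; the value at \<open>m\<close> is overwritten by the
    update.\<close>
  define Y where "Y \<omega> = (\<lambda>j. if j < m then a j \<omega> + \<xi> j \<omega> else 0)" for \<omega>
  define X where "X \<omega> = (\<lambda>j. if j < m then \<xi> j \<omega> else 0)" for \<omega>
  have YG: "Y \<in> G m \<rightarrow>\<^sub>M seq_borel"
    unfolding Y_def by (intro measurable_seq_truncate borel_measurable_add aG \<xi>G) (use m in auto)
  have XG: "X \<in> G m \<rightarrow>\<^sub>M seq_borel"
    unfolding X_def by (intro measurable_seq_truncate \<xi>G) (use m in auto)
  have YM [measurable]: "Y \<in> M \<rightarrow>\<^sub>M seq_borel" using measurable_from_subalg[OF G[OF m] YG] .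
  have am: "a m \<in> borel_measurable (G m)" using aG m by simp
  have Y_Suc: "(\<lambda>j. if j < Suc m then a j \<omega> + \<xi> j \<omega> else 0) = (Y \<omega>)(m := a m \<omega> + \<xi> m \<omega>)" for \<omega>
    by (auto simp: Y_def less_Suc_eq)
  have X_Suc: "(\<lambda>j. if j < Suc m then \<xi> j \<omega> else 0) = (X \<omega>)(m := \<xi> m \<omega>)" for \<omega>
    by (auto simp: X_def less_Suc_eq)
  have F'_int: "integrable M (\<lambda>\<omega>. F' (Y \<omega>))"
    by (intro integrable_const_bound[where B=C] AE_I2) (use F'_bound in auto)
  have "(\<lambda>(p, x). ((fst p)(m := snd p + x)))
      \<in> (seq_borel \<Otimes>\<^sub>M borel) \<Otimes>\<^sub>M borel \<rightarrow>\<^sub>M (seq_borel :: (nat \<Rightarrow> real ^ 'n) measure)"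
  proof -
    have "(\<lambda>p. (fst (fst p), snd (fst p) + snd p))
        \<in> (seq_borel \<Otimes>\<^sub>M borel) \<Otimes>\<^sub>M borel \<rightarrow>\<^sub>M (seq_borel :: (nat \<Rightarrow> real ^ 'n) measure) \<Otimes>\<^sub>M (borel :: (real ^ 'n) measure)"
      by measurable
    from measurable_compose[OF this measurable_seq_upd[of m]]
    show ?thesis by (simp add: split_beta' del: fun_upd_apply)
  qed
  from measurable_compose[OF this Suc.prems(1)]
  have "(\<lambda>(p, x). F ((fst p)(m := snd p + x))) \<in> borel_measurable ((seq_borel \<Otimes>\<^sub>M borel) \<Otimes>\<^sub>M borel)"
    by (simp add: split_beta' del: fun_upd_apply)
  \<comment> \<open>The shifted past and the current shift \<open>a m\<close> are both known before
    the increment \<open>\<xi> m\<close>. The pair is frozen, and the entropy bound is then applied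
    pointwise with the constant shift \<open>a m \<omega>\<close>.\<close>
  note split = expectation_indep_split[OF G[OF m] indep[OF m] \<xi>[OF m] measurable_Pair[OF YG am] this Suc.prems(2)]
  from split(2) have "expectation (\<lambda>\<omega>. F ((Y \<omega>)(m := a m \<omega> + \<xi> m \<omega>))) =
      expectation (\<lambda>\<omega>. \<integral>x. F ((Y \<omega>)(m := a m \<omega> + x)) \<partial>gaussian \<delta>)"
    by (simp add: law[OF m] del: fun_upd_apply)
  also have "\<dots> \<le> expectation (\<lambda>\<omega>. F' (Y \<omega>) + (norm (a m \<omega>))\<^sup>2 / (2 * \<delta>))"
  proof (rule integral_mono)
    show "integrable M (\<lambda>\<omega>. \<integral>x. F ((Y \<omega>)(m := a m \<omega> + x)) \<partial>gaussian \<delta>)"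
      using split(1) by (simp add: law[OF m] del: fun_upd_apply)
    show "integrable M (\<lambda>\<omega>. F' (Y \<omega>) + (norm (a m \<omega>))\<^sup>2 / (2 * \<delta>))"
      using int_a[OF m] F'_int by simp
    show "(\<integral>x. F ((Y \<omega>)(m := a m \<omega> + x)) \<partial>gaussian \<delta>) \<le> F' (Y \<omega>) + (norm (a m \<omega>))\<^sup>2 / (2 * \<delta>)" for \<omega>
      unfolding F'_def
      by (rule gaussian_shift_entropy[OF \<delta> prob Fupd1 Suc.prems(2)])
  qed
  also have "\<dots> = expectation (\<lambda>\<omega>. F' (Y \<omega>)) + expectation (\<lambda>\<omega>. (norm (a m \<omega>))\<^sup>2) / (2 * \<delta>)"
    using int_a[OF m] F'_int by simp
  also have "expectation (\<lambda>\<omega>. F' (Y \<omega>)) \<le> ln (expectation (\<lambda>\<omega>. exp (F' (X \<omega>)))) +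
    (\<Sum>i<m. expectation (\<lambda>\<omega>. (norm (a i \<omega>))\<^sup>2) / (2 * \<delta>))"
    unfolding Y_def X_def using m F'_bound by (intro Suc.IH F'_meas) auto
  \<comment> \<open>The same freezing, now without a shift, reassembles the exponential moment of
    the first \<open>Suc m\<close> increments.\<close>
  also have "expectation (\<lambda>\<omega>. exp (F' (X \<omega>))) = expectation (\<lambda>\<omega>. exp (F ((X \<omega>)(m := \<xi> m \<omega>))))"
  proof -
    have 1: "(\<lambda>(y, x). exp (F (y(m := x)))) \<in> borel_measurable (seq_borel \<Otimes>\<^sub>M borel)"
      using measurable_compose[OF Fupd borel_measurable_exp] by (simp add: split_beta' del: fun_upd_apply)
    have 2: "\<bar>exp (F (y(m := x)))\<bar> \<le> exp C" for x y
      using Suc.prems(2)[of "y(m := x)"] by (simp add: abs_le_iff del: fun_upd_apply)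
    from expectation_indep_split[OF G[OF m] indep[OF m] \<xi>[OF m] XG 1 2]
    show ?thesis by (simp add: law[OF m] expF del: fun_upd_apply)
  qed
  finally show ?case by (simp add: X_Suc Y_Suc del: fun_upd_apply)
qed


section \<open>Cameron-Martin paths and completed filtrations\<close>

lemma cm_density_integrable:
  fixes d :: "real \<Rightarrow> real ^ 'n"
  assumes "cm_density h d"
  shows "set_integrable lborel {0..1} d" and "set_integrable lborel {0..1} (\<lambda>s. (norm (d s))\<^sup>2)"
proof -
  show 2: "set_integrable lborel {0..1} (\<lambda>s. (norm (d s))\<^sup>2)" using assms by (simp add: cm_density_def)
  show "set_integrable lborel {0..1} d"
  proof (rule set_integrable_bound)
    show "set_integrable lborel {0..1} (\<lambda>s. 1 + (norm (d s))\<^sup>2)"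
      using 2 by (intro set_integral_add) (auto simp: set_integrable_def)
    show "set_borel_measurable lborel {0..1} d" using assms by (simp add: cm_density_def)
    have "norm x \<le> norm (1 + (norm x)\<^sup>2)" for x :: "real ^ 'n"
    proof -
      have "norm x \<le> 1 + (norm x)\<^sup>2"
        using sum_squares_bound[of 1 "norm x"] norm_ge_zero[of x] unfolding power_one by linarith
      then show ?thesis using abs_ge_self[of "1 + (norm x)\<^sup>2"] unfolding real_norm_def by linarith
    qed
    then show "AE x in lborel. x \<in> {0..1} \<longrightarrow> norm (d x) \<le> norm (1 + (norm (d x))\<^sup>2)"
      by simp
  qed
qed

text \<open>Cauchy-Schwarz on \<open>{s<..t}\<close>. The right side is written as a difference of
  energies so that it telescopes along a grid.\<close>

lemma cm_density_increment:
  assumes cm: "cm_density h d" and st: "0 \<le> s" "s \<le> t" "t \<le> 1"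
  shows "(norm (h t - h s))\<^sup>2 \<le>
    (t - s) * ((LINT r:{0..t}|lborel. (norm (d r))\<^sup>2) - (LINT r:{0..s}|lborel. (norm (d r))\<^sup>2))"
proof -
  note int = cm_density_integrable[OF cm]
  have split: "(LINT r:{0..t}|lborel. g r) - (LINT r:{0..s}|lborel. g r) = (LINT r:{s<..t}|lborel. g r)"
    if "set_integrable lborel {0..1} g" for g :: "real \<Rightarrow> 'b::{banach, second_countable_topology}"
  proof -
    have "{0..t} = {0..s} \<union> {s<..t}" using st by auto
    moreover have "set_integrable lborel {0..s} g" "set_integrable lborel {s<..t} g"
      using st by (auto intro!: set_integrable_subset[OF that])
    ultimately have "(LINT r:{0..t}|lborel. g r) = (LINT r:{0..s}|lborel. g r) + (LINT r:{s<..t}|lborel. g r)"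
      by (simp only:) (rule set_integral_Un, auto)
    then show ?thesis by simp
  qed
  have sub: "{s<..t} \<subseteq> {0..1}" using st by auto
  have d: "set_integrable lborel {s<..t} d" and d2: "set_integrable lborel {s<..t} (\<lambda>r. (norm (d r))\<^sup>2)"
    using sub by (auto intro!: set_integrable_subset[OF int(1)] set_integrable_subset[OF int(2)])
  define I where "I = (LINT r:{s<..t}|lborel. norm (d r))"
  define Q where "Q = (LINT r:{s<..t}|lborel. (norm (d r))\<^sup>2)"
  have "h t - h s = (LINT r:{s<..t}|lborel. d r)"
    using cm st split[OF int(1)] by (simp add: cm_density_def)
  then have "norm (h t - h s) \<le> I"
    using set_integral_norm_bound[OF d] by (simp add: I_def)
  then have le: "(norm (h t - h s))\<^sup>2 \<le> I\<^sup>2" by (intro power_mono) auto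
  have "I\<^sup>2 \<le> (t - s) * Q"
  proof (cases "s = t")
    case True
    then show ?thesis by (simp add: I_def Q_def set_lebesgue_integral_def)
  next
    case False
    then have pos: "t - s > 0" using st by simp
    \<comment> \<open>The mean of the norm of \<open>d\<close> over the interval: expanding the
      nonnegative integral of \<open>(norm (d r) - c)\<^sup>2\<close> with this \<open>c\<close> is
      Cauchy-Schwarz.\<close>
    define c where "c = I / (t - s)"
    have const: "set_integrable lborel {s<..t} (\<lambda>_. c\<^sup>2)"
      using st unfolding set_integrable_def
      by (intro integrable_scaleR_left integrable_real_indicator) auto
    have n: "set_integrable lborel {s<..t} (\<lambda>r. 2 * c * norm (d r))"
      using set_integrable_norm[OF d] by simp
    have "0 \<le> (LINT r:{s<..t}|lborel. (norm (d r) - c)\<^sup>2)"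
      unfolding set_lebesgue_integral_def by (rule integral_nonneg_AE) simp
    also have "\<dots> = (LINT r:{s<..t}|lborel. (norm (d r))\<^sup>2 - 2 * c * norm (d r) + c\<^sup>2)"
      by (simp add: power2_diff algebra_simps)
    also have "\<dots> = Q - 2 * c * I + c\<^sup>2 * (t - s)"
    proof -
      have "(LINT r:{s<..t}|lborel. (norm (d r))\<^sup>2 - 2 * c * norm (d r) + c\<^sup>2) =
          (LINT r:{s<..t}|lborel. (norm (d r))\<^sup>2 - 2 * c * norm (d r)) + (LINT r:{s<..t}|lborel. c\<^sup>2)"
        by (rule set_integral_add(2)[OF set_integral_diff(1)[OF d2 n] const])
      also have "(LINT r:{s<..t}|lborel. (norm (d r))\<^sup>2 - 2 * c * norm (d r)) = Q - 2 * c * I"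
        unfolding set_integral_diff(2)[OF d2 n] by (simp add: Q_def I_def)
      also have "(LINT r:{s<..t}|lborel. c\<^sup>2) = c\<^sup>2 * (t - s)"
        using st by (simp add: set_lebesgue_integral_def)
      finally show ?thesis .
    qed
    finally have "0 \<le> Q - 2 * c * I + c\<^sup>2 * (t - s)" .
    also have "\<dots> = Q - I\<^sup>2 / (t - s)"
    proof -
      have "c\<^sup>2 * (t - s) = c * I" using pos by (simp add: c_def power2_eq_square)
      then show ?thesis by (simp add: c_def power2_eq_square)
    qed
    finally show ?thesis using pos by (simp add: field_simps)
  qed
  then show ?thesis using le split[OF int(2)] by (simp add: Q_def)
qed

lemma cm_energy_mono:
  assumes cm: "cm_density h d" and "s \<le> t" "t \<le> 1"
  shows "(LINT r:{0..s}|lborel. (norm (d r))\<^sup>2) \<le> (LINT r:{0..t}|lborel. (norm (d r))\<^sup>2)"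
proof -
  have "set_integrable lborel {0..a} (\<lambda>r. (norm (d r))\<^sup>2)" if "a \<le> 1" for a
    by (rule set_integrable_subset[OF cm_density_integrable(2)[OF cm]]) (use that in auto)
  then show ?thesis
    using assms(2,3) unfolding set_integrable_def set_lebesgue_integral_def
    by (intro integral_mono) (auto simp: indicator_def)
qed

lemma cm_energy_nonneg: "0 \<le> (LINT r:A|lborel. (norm (d r))\<^sup>2)"
  unfolding set_lebesgue_integral_def by (rule integral_nonneg_AE) simp

text \<open>Finite energy even gives Hoelder continuity of order 1/2, by the increment
  bound.\<close>

lemma cm_density_continuous:
  assumes cm: "cm_density h d"
  shows "continuous_on {0..1} h"
proof -
  define K where "K = (LINT r:{0..1}|lborel. (norm (d r))\<^sup>2)"
  have "K \<ge> 0" unfolding K_def by (rule cm_energy_nonneg)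
  have bnd: "norm (h t - h s) \<le> sqrt (K * (t - s))" if "0 \<le> s" "s \<le> t" "t \<le> 1" for s t
  proof (rule real_le_rsqrt)
    note cm_density_increment[OF cm that]
    also have "(t - s) * ((LINT r:{0..t}|lborel. (norm (d r))\<^sup>2) - (LINT r:{0..s}|lborel. (norm (d r))\<^sup>2))
        \<le> (t - s) * K"
      using that cm_energy_mono[OF cm, of t 1] cm_energy_nonneg[of "{0..s}" d]
      by (intro mult_left_mono) (auto simp: K_def)
    finally show "(norm (h t - h s))\<^sup>2 \<le> K * (t - s)" by (simp add: mult.commute)
  qed
  have bnd': "norm (h t - h s) \<le> sqrt (K * \<bar>t - s\<bar>)" if "s \<in> {0..1}" "t \<in> {0..1}" for s t
    using bnd[of s t] bnd[of t s] that by (cases "s \<le> t") (auto simp: norm_minus_commute)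
  show ?thesis
    unfolding continuous_on_def
  proof
    fix s :: real assume s: "s \<in> {0..1}"
    have "((\<lambda>t. sqrt (K * \<bar>t - s\<bar>)) \<longlongrightarrow> sqrt (K * \<bar>s - s\<bar>)) (at s within {0..1})"
      by (intro tendsto_intros)
    then have lim: "((\<lambda>t. sqrt (K * \<bar>t - s\<bar>)) \<longlongrightarrow> 0) (at s within {0..1})" by simp
    have "((\<lambda>t. h t - h s) \<longlongrightarrow> 0) (at s within {0..1})"
      by (rule Lim_null_comparison[OF _ lim])
        (use bnd'[OF s] in \<open>auto simp: eventually_at_filter\<close>)
    then show "(h \<longlongrightarrow> h s) (at s within {0..1})" by (simp add: Lim_null[symmetric])
  qed
qed

text \<open>Each increment bound carries the cell length \<open>1 / N\<close>, which cancels against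
  \<open>real N\<close>, and the energies telescope. The case \<open>m < N\<close> serves the
  delayed grid, where the last increment is dropped.\<close>

lemma cm_density_grid_energy:
  fixes N :: nat
  assumes cm: "cm_density h d" and N: "N > 0" and m: "m \<le> N"
  shows "real N * (\<Sum>i<m. (norm (h (real (Suc i) / N) - h (real i / N)))\<^sup>2) \<le>
    (LINT r:{0..1}|lborel. (norm (d r))\<^sup>2)"
proof -
  define Q where "Q t = (LINT r:{0..t}|lborel. (norm (d r))\<^sup>2)" for t
  have "real N * (norm (h (real (Suc i) / N) - h (real i / N)))\<^sup>2 \<le> Q (real (Suc i) / N) - Q (real i / N)"
    if "i < m" for i
  proof -
    have eq: "real (Suc i) / N - real i / N = 1 / N" by (simp add: add_divide_distrib)
    have "(norm (h (real (Suc i) / N) - h (real i / N)))\<^sup>2 \<le>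
        (real (Suc i) / N - real i / N) * (Q (real (Suc i) / N) - Q (real i / N))"
      unfolding Q_def using that m N
      by (intro cm_density_increment[OF cm]) (auto intro!: divide_right_mono simp: divide_le_eq)
    then show ?thesis unfolding eq using N by (simp add: field_simps)
  qed
  then have "real N * (\<Sum>i<m. (norm (h (real (Suc i) / N) - h (real i / N)))\<^sup>2) \<le>
      (\<Sum>i<m. Q (real (Suc i) / N) - Q (real i / N))"
    unfolding sum_distrib_left by (intro sum_mono) auto
  also have "\<dots> = Q (real m / N) - Q 0"
    by (induction m) auto
  also have "\<dots> \<le> Q 1"
    using cm_energy_mono[OF cm, of "real m / N" 1] cm_energy_nonneg[of "{0..0}" d] m N
    by (simp add: Q_def)
  finally show ?thesis by (simp add: Q_def)
qed

section \<open>Completed filtrations: generators, monotonicity, evaluations\<close>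

lemma completed_filtration_gen:
  "{(\<lambda>\<omega>. X \<omega> s) -` B \<inter> space M | s B. s \<in> {0..t} \<and> B \<in> sets borel} \<union> null_sets (completion M)
    \<subseteq> Pow (space M)"
  using sets.sets_into_space[of _ "completion M"] by auto

lemma space_completed_filtration [simp]: "space (completed_filtration M X t) = space M"
  unfolding completed_filtration_def by (rule space_measure_of[OF completed_filtration_gen])

lemma sets_completed_filtration:
  "sets (completed_filtration M X t) = sigma_sets (space M)
    ({(\<lambda>\<omega>. X \<omega> s) -` B \<inter> space M | s B. s \<in> {0..t} \<and> B \<in> sets borel} \<union> null_sets (completion M))"
  unfolding completed_filtration_def by (rule sets_measure_of[OF completed_filtration_gen])

lemma completed_filtration_mono:
  assumes "s \<le> t"
  shows "sets (completed_filtration M X s) \<subseteq> sets (completed_filtration M X t)"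
  unfolding sets_completed_filtration
proof (rule sigma_sets_mono')
  have "{0..s} \<subseteq> {0..t}" using assms by simp
  then show "{(\<lambda>\<omega>. X \<omega> s') -` B \<inter> space M |s' B. s' \<in> {0..s} \<and> B \<in> sets borel} \<union> null_sets (completion M)
    \<subseteq> {(\<lambda>\<omega>. X \<omega> s') -` B \<inter> space M |s' B. s' \<in> {0..t} \<and> B \<in> sets borel} \<union> null_sets (completion M)"
    by blast
qed

lemma measurable_completed_filtration_mono:
  assumes "s \<le> t" "f \<in> completed_filtration M X s \<rightarrow>\<^sub>M N"
  shows "f \<in> completed_filtration M X t \<rightarrow>\<^sub>M N"
  using assms completed_filtration_mono[OF assms(1), of M X] by (auto simp: measurable_def)

lemma null_sets_completed_filtration:
  "A \<in> null_sets (completion M) \<Longrightarrow> A \<in> sets (completed_filtration M X t)"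
  unfolding sets_completed_filtration by auto

lemma measurable_completed_filtration_eval:
  fixes X :: "'a \<Rightarrow> real \<Rightarrow> real ^ 'n"
  assumes "s \<in> {0..t}"
  shows "(\<lambda>\<omega>. X \<omega> s) \<in> borel_measurable (completed_filtration M X t)"
proof (rule measurableI)
  fix B :: "(real ^ 'n) set" assume "B \<in> sets borel"
  then show "(\<lambda>\<omega>. X \<omega> s) -` B \<inter> space (completed_filtration M X t) \<in> sets (completed_filtration M X t)"
    unfolding sets_completed_filtration using assms by (auto intro!: sigma_sets.Basic)
qed simp

lemma measurable_path_eval:
  assumes "t \<in> {0..1}" and "X \<in> M \<rightarrow>\<^sub>M path_space"
  shows "(\<lambda>\<omega>. X \<omega> t) \<in> borel_measurable M"
proof -
  have "(\<lambda>x. x t) \<in> path_space \<rightarrow>\<^sub>M borel"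
    unfolding path_space_def
    by (intro measurable_restrict_space1 measurable_component_singleton assms(1))
  from measurable_compose[OF assms(2) this] show ?thesis .
qed


section \<open>Adapted shifts of Brownian motion\<close>

definition grid_path :: "nat \<Rightarrow> (nat \<Rightarrow> 'b::real_normed_vector) \<Rightarrow> real \<Rightarrow> 'b" where
  "grid_path N y = (\<lambda>t\<in>{0..1}. \<Sum>j<nat \<lfloor>real N * t\<rfloor>. y j)"

text \<open>The target is the full product space and not \<open>path_space\<close>, since step paths
  are discontinuous.\<close>

lemma measurable_grid_path:
  "grid_path N \<in> seq_borel \<rightarrow>\<^sub>M (PiM {0..1} (\<lambda>_. borel) :: (real \<Rightarrow> real ^ 'n) measure)"
  unfolding grid_path_def by (intro measurable_restrict borel_measurable_sum) measurable

definition grid_increment :: "nat \<Rightarrow> (real \<Rightarrow> 'b) \<Rightarrow> nat \<Rightarrow> 'b::real_normed_vector" where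
  "grid_increment N b j = b (real (Suc j) / N) - b (real j / N)"

text \<open>Shifted by one index, so that the value at \<open>j\<close> is known at time \<open>j / N\<close>.\<close>

definition delayed_increment :: "nat \<Rightarrow> (real \<Rightarrow> 'b) \<Rightarrow> nat \<Rightarrow> 'b::real_normed_vector" where
  "delayed_increment N v j = (if j = 0 then 0 else grid_increment N v (j - 1))"

lemma sum_grid_increment: "(\<Sum>j<k. grid_increment N b j) = b (real k / N) - b 0"
  by (induction k) (auto simp: grid_increment_def)

text \<open>Telescoping with one increment missing. Truncated subtraction covers
  \<open>k = 0\<close>, where both sides vanish.\<close>

lemma sum_delayed_increment: "(\<Sum>j<k. delayed_increment N v j) = v (real (k - 1) / N) - v 0"
proof (cases k)
  case (Suc m)
  have "(\<Sum>j<Suc m. delayed_increment N v j) = (\<Sum>j<m. grid_increment N v j)"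
    unfolding sum.lessThan_Suc_shift by (simp add: delayed_increment_def)
  then show ?thesis using Suc by (simp add: sum_grid_increment)
qed simp

lemma grid_floor_le:
  assumes "t \<in> {0..1}"
  shows "nat \<lfloor>real N * t\<rfloor> \<le> N"
proof -
  have "real N * t \<le> real N" using assms by (simp add: mult_left_le)
  then have "\<lfloor>real N * t\<rfloor> \<le> int N" by (metis floor_mono floor_of_nat)
  then show ?thesis by simp
qed

text \<open>Both times lie between \<open>t - 2 / N\<close> and \<open>t\<close>: at most one cell
  is lost to rounding down and one more to the delay.\<close>

lemma grid_times_converge:
  assumes t: "t \<in> {0..1}"
  shows "(\<lambda>N. real (nat \<lfloor>real N * t\<rfloor>) / N) \<longlonglongrightarrow> t"
    and "(\<lambda>N. real (nat \<lfloor>real N * t\<rfloor> - 1) / N) \<longlonglongrightarrow> t"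
proof -
  have low: "(\<lambda>N. t - 2 / real N) \<longlonglongrightarrow> t"
    using tendsto_diff[OF tendsto_const lim_const_over_n[of 2], of t] by simp
  have bnd: "t - 2 / N \<le> real (nat \<lfloor>real N * t\<rfloor> - 1) / N"
    "t - 2 / N \<le> real (nat \<lfloor>real N * t\<rfloor>) / N"
    "real (nat \<lfloor>real N * t\<rfloor> - 1) / N \<le> real (nat \<lfloor>real N * t\<rfloor>) / N"
    "real (nat \<lfloor>real N * t\<rfloor>) / N \<le> t" if "N > 0" for N :: nat
  proof -
    have nn: "0 \<le> \<lfloor>real N * t\<rfloor>" using t by simp
    then have *: "real (nat \<lfloor>real N * t\<rfloor>) = of_int \<lfloor>real N * t\<rfloor>" by simp
    then have "real N * t - 2 \<le> real (nat \<lfloor>real N * t\<rfloor> - 1)" by linarith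
    then have "(real N * t - 2) / N \<le> real (nat \<lfloor>real N * t\<rfloor> - 1) / N"
      by (intro divide_right_mono) auto
    then show "t - 2 / N \<le> real (nat \<lfloor>real N * t\<rfloor> - 1) / N"
      using that by (simp add: diff_divide_distrib)
    show "real (nat \<lfloor>real N * t\<rfloor> - 1) / N \<le> real (nat \<lfloor>real N * t\<rfloor>) / N"
      by (intro divide_right_mono) auto
    with \<open>t - 2 / N \<le> real (nat \<lfloor>real N * t\<rfloor> - 1) / N\<close>
    show "t - 2 / N \<le> real (nat \<lfloor>real N * t\<rfloor>) / N" by (rule order_trans)
    have "real (nat \<lfloor>real N * t\<rfloor>) \<le> real N * t" using * by linarith
    then show "real (nat \<lfloor>real N * t\<rfloor>) / N \<le> t" using that by (simp add: field_simps)
  qed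
  show "(\<lambda>N. real (nat \<lfloor>real N * t\<rfloor>) / N) \<longlonglongrightarrow> t"
    by (rule tendsto_sandwich[OF _ _ low tendsto_const])
      (use bnd(2,4) in \<open>auto intro!: eventually_sequentiallyI[of 1]\<close>)
  show "(\<lambda>N. real (nat \<lfloor>real N * t\<rfloor> - 1) / N) \<longlonglongrightarrow> t"
    by (rule tendsto_sandwich[OF _ _ low tendsto_const])
      (use bnd(1) order_trans[OF bnd(3,4)] in \<open>auto intro!: eventually_sequentiallyI[of 1]\<close>)
qed

text \<open>Pointwise convergence is used because discontinuous step paths are to approximate
  continuous ones. A constant sequence \<open>X\<close> shows that the value depends only on the
  restriction to \<open>{0..1}\<close>.\<close>

definition test_functional :: "((real \<Rightarrow> real ^ 'n) \<Rightarrow> real) \<Rightarrow> bool" where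
  "test_functional \<Phi> \<longleftrightarrow>
     \<Phi> \<in> borel_measurable (PiM {0..1} (\<lambda>_. borel)) \<and> (\<exists>C. \<forall>x. \<bar>\<Phi> x\<bar> \<le> C) \<and>
     (\<forall>X x. (\<forall>t\<in>{0..1}. (\<lambda>k. X k t) \<longlonglongrightarrow> x t) \<longrightarrow> (\<lambda>k. \<Phi> (X k)) \<longlonglongrightarrow> \<Phi> x)"

lemma tendsto_continuous_seq:
  assumes "continuous_on S f" "x \<in> S" "\<And>k. y k \<in> S" "y \<longlonglongrightarrow> x"
  shows "(\<lambda>k. f (y k)) \<longlonglongrightarrow> f x"
  by (rule continuous_on_tendsto_compose[OF assms(1,4,2)]) (use assms(3) in auto)

text \<open>The sums telescope to values at grid times converging to \<open>t\<close>, and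
  continuity finishes. Cutting off at index \<open>N\<close> changes nothing, as at most
  \<open>N\<close> increments are summed for \<open>t\<close> in \<open>{0..1}\<close>.\<close>

lemma grid_path_converges:
  assumes b: "continuous_on {0..1} b" "b 0 = 0" and v: "continuous_on {0..1} v" "v 0 = 0"
    and t: "t \<in> {0..1}"
  shows "(\<lambda>N. grid_path N (\<lambda>j. if j < N then grid_increment N b j else 0) t) \<longlonglongrightarrow> b t"
    and "(\<lambda>N. grid_path N (\<lambda>j. if j < N then delayed_increment N v j + grid_increment N b j else 0) t)
      \<longlonglongrightarrow> b t + v t"
proof -
  let ?k = "\<lambda>N. nat \<lfloor>real N * t\<rfloor>"
  have trunc: "(\<Sum>j<?k N. if j < N then g j else 0) = (\<Sum>j<?k N. g j)" for N and g :: "nat \<Rightarrow> 'a"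
    using grid_floor_le[OF t, of N] by (intro sum.cong) auto
  have in01: "real (?k N) / N \<in> {0..1}" "real (?k N - 1) / N \<in> {0..1}" for N
    using grid_floor_le[OF t, of N] by (auto simp: divide_le_eq)
  have B: "(\<lambda>N. b (real (?k N) / N)) \<longlonglongrightarrow> b t"
    by (rule tendsto_continuous_seq[OF b(1) t in01(1) grid_times_converge(1)[OF t]])
  have V: "(\<lambda>N. v (real (?k N - 1) / N)) \<longlonglongrightarrow> v t"
    by (rule tendsto_continuous_seq[OF v(1) t in01(2) grid_times_converge(2)[OF t]])
  show "(\<lambda>N. grid_path N (\<lambda>j. if j < N then grid_increment N b j else 0) t) \<longlonglongrightarrow> b t"
    using B t b(2) by (simp add: grid_path_def trunc sum_grid_increment)
  show "(\<lambda>N. grid_path N (\<lambda>j. if j < N then delayed_increment N v j + grid_increment N b j else 0) t)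
      \<longlonglongrightarrow> b t + v t"
    using tendsto_add[OF B V] t b(2) v(2)
    by (simp add: grid_path_def trunc sum.distrib sum_grid_increment sum_delayed_increment add.commute)
qed

text \<open>The discrete bound with cells of length \<open>1 / N\<close> has a right side controlled
  by \<open>K\<close> uniformly in \<open>N\<close>. Continuity of \<open>\<Phi>\<close> and its
  boundedness then give both limits by dominated convergence.\<close>

lemma (in prob_space) continuous_variational_bound:
  fixes \<beta> v :: "'a \<Rightarrow> real \<Rightarrow> real ^ 'n"
  assumes bm: "brownian_motion M \<beta>"
    and vG: "\<And>t. t \<in> {0..1} \<Longrightarrow> (\<lambda>\<omega>. v \<omega> t) \<in> borel_measurable (completed_filtration M \<beta> t)"
    and vM: "\<And>t. t \<in> {0..1} \<Longrightarrow> (\<lambda>\<omega>. v \<omega> t) \<in> borel_measurable M"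
    and cm: "AE \<omega> in M. \<exists>h d. cm_density h d \<and> (\<forall>t\<in>{0..1}. v \<omega> t = h t) \<and>
      (LINT r:{0..1}|lborel. (norm (d r))\<^sup>2) \<le> K \<omega>"
    and K: "integrable M K"
    and \<Phi>: "test_functional \<Phi>"
  shows "expectation (\<lambda>\<omega>. \<Phi> (path_add (\<beta> \<omega>) (v \<omega>))) \<le>
    ln (expectation (\<lambda>\<omega>. exp (\<Phi> (\<lambda>t\<in>{0..1}. \<beta> \<omega> t)))) + expectation K / 2"
proof -
  have \<beta>M: "\<beta> \<in> M \<rightarrow>\<^sub>M path_space" and \<beta>0: "AE \<omega> in M. \<beta> \<omega> 0 = 0"
    and incr: "\<And>s t. 0 \<le> s \<Longrightarrow> s < t \<Longrightarrow> t \<le> 1 \<Longrightarrow>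
        indep_set (sets (completed_filtration M \<beta> s))
          (sets (vimage_algebra (space M) (\<lambda>\<omega>. \<beta> \<omega> t - \<beta> \<omega> s) borel)) \<and>
        distributed M lborel (\<lambda>\<omega>. \<beta> \<omega> t - \<beta> \<omega> s)
          (\<lambda>x. ennreal (\<Prod>i\<in>UNIV. normal_density 0 (sqrt (t - s)) (x $ i)))"
    using bm unfolding brownian_motion_def by auto
  have \<beta>eval: "(\<lambda>\<omega>. \<beta> \<omega> t) \<in> borel_measurable M" if "t \<in> {0..1}" for t
    by (rule measurable_path_eval[OF that \<beta>M])
  have \<Phi>M: "\<Phi> \<in> borel_measurable (PiM {0..1} (\<lambda>_. borel))"
    and \<Phi>cont: "\<And>X x. (\<And>t. t \<in> {0..1} \<Longrightarrow> (\<lambda>k. X k t) \<longlonglongrightarrow> x t) \<Longrightarrow> (\<lambda>k. \<Phi> (X k)) \<longlonglongrightarrow> \<Phi> x"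
    using \<Phi> unfolding test_functional_def by auto
  obtain C where C: "\<And>x. \<bar>\<Phi> x\<bar> \<le> C" using \<Phi> unfolding test_functional_def by auto
  have grid: "real j / real N \<in> {0..1}" if "j \<le> N" for j N :: nat
    using that by (auto simp: divide_le_eq)
  define F where "F N y = \<Phi> (grid_path N y)" for N y
  have FM: "F N \<in> borel_measurable seq_borel" for N
    unfolding F_def by (rule measurable_compose[OF measurable_grid_path \<Phi>M])
  define \<xi> where "\<xi> N j \<omega> = grid_increment N (\<beta> \<omega>) j" for N j \<omega>
  define a where "a N j \<omega> = delayed_increment N (v \<omega>) j" for N j \<omega>
  have \<xi>M: "\<xi> N j \<in> borel_measurable M" if "j < N" for N j
    unfolding \<xi>_def grid_increment_def using that
    by (intro borel_measurable_diff \<beta>eval grid) auto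
  have aM: "a N j \<in> borel_measurable M" if "j < N" for N j
    unfolding a_def delayed_increment_def grid_increment_def using that
    by (cases "j = 0") (auto intro!: borel_measurable_diff vM simp: divide_le_eq)
  have energy: "AE \<omega> in M. real N * (\<Sum>j<N. (norm (a N j \<omega>))\<^sup>2) \<le> K \<omega>" if "N > 0" for N
    using cm
  proof eventually_elim
    case (elim \<omega>)
    then obtain h d where h: "cm_density h d" "\<And>t. t \<in> {0..1} \<Longrightarrow> v \<omega> t = h t"
      "(LINT r:{0..1}|lborel. (norm (d r))\<^sup>2) \<le> K \<omega>" by auto
    \<comment> \<open>The delayed shift starts with 0, so the \<open>N\<close> shifts contain only
      the first \<open>N - 1\<close> increments of the path.\<close>
    obtain m where m: "N = Suc m" using \<open>N > 0\<close> gr0_implies_Suc by blast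
    have "(\<Sum>j<N. (norm (a N j \<omega>))\<^sup>2) = (\<Sum>j<m. (norm (grid_increment N (v \<omega>) j))\<^sup>2)"
      unfolding m sum.lessThan_Suc_shift by (simp add: a_def delayed_increment_def)
    also have "\<dots> = (\<Sum>j<m. (norm (h (real (Suc j) / N) - h (real j / N)))\<^sup>2)"
      unfolding grid_increment_def using m by (intro sum.cong) (auto simp: h(2) divide_le_eq)
    finally show ?case
      using cm_density_grid_energy[OF h(1) that, of m] h(3) m by simp
  qed
  have int_a: "integrable M (\<lambda>\<omega>. (norm (a N j \<omega>))\<^sup>2)" if "j < N" for N j
  proof (rule Bochner_Integration.integrable_bound[OF K])
    show "(\<lambda>\<omega>. (norm (a N j \<omega>))\<^sup>2) \<in> borel_measurable M" using aM[OF that] by measurable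
    show "AE \<omega> in M. norm ((norm (a N j \<omega>))\<^sup>2) \<le> norm (K \<omega>)"
      using energy[OF order.strict_trans1[OF le0 that]]
    proof eventually_elim
      case (elim \<omega>)
      have "(norm (a N j \<omega>))\<^sup>2 \<le> (\<Sum>j<N. (norm (a N j \<omega>))\<^sup>2)"
        using that by (intro member_le_sum) auto
      also have "\<dots> \<le> real N * (\<Sum>j<N. (norm (a N j \<omega>))\<^sup>2)"
        using that mult_right_mono[of 1 "real N" "\<Sum>j<N. (norm (a N j \<omega>))\<^sup>2"] by (simp add: sum_nonneg)
      finally show ?case using elim that by simp
    qed
  qed
  have discrete: "expectation (\<lambda>\<omega>. F N (\<lambda>j. if j < N then a N j \<omega> + \<xi> N j \<omega> else 0)) \<le>
      ln (expectation (\<lambda>\<omega>. exp (F N (\<lambda>j. if j < N then \<xi> N j \<omega> else 0)))) + expectation K / 2"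
    if N: "N > 0" for N
  proof -
    define G where "G i = completed_filtration M \<beta> (real i / N)" for i :: nat
    have step: "real (Suc i) / N - real i / N = 1 / N" for i :: nat by (simp add: add_divide_distrib)
    have ind: "indep_set (sets (G i)) (sets (vimage_algebra (space M) (\<xi> N i) borel))"
      and dis: "distributed M lborel (\<xi> N i) (\<lambda>x. ennreal (\<Prod>i\<in>UNIV. normal_density 0 (sqrt (1 / N)) (x $ i)))"
      if "i < N" for i
      using incr[of "real i / N" "real (Suc i) / N"] that N grid[of "Suc i" N]
      unfolding G_def \<xi>_def grid_increment_def step by (auto simp: divide_strict_right_mono)
    have \<xi>G: "\<xi> N j \<in> borel_measurable (G i)" if "j < i" for i j
      unfolding \<xi>_def grid_increment_def G_def using that N
      by (intro borel_measurable_diff measurable_completed_filtration_eval) (auto simp: divide_right_mono)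
    have vG': "(\<lambda>\<omega>. v \<omega> (real j / N)) \<in> borel_measurable (G i)" if "j \<le> i" "j \<le> N" for i j
      unfolding G_def
      by (rule measurable_completed_filtration_mono[OF _ vG[OF grid[OF that(2)]]])
        (use that in \<open>auto simp: divide_right_mono\<close>)
    have aG: "a N j \<in> borel_measurable (G i)" if "j \<le> i" "i < N" for i j
    proof (cases j)
      case (Suc k)
      then show ?thesis
        unfolding a_def delayed_increment_def grid_increment_def using that
        by (auto intro!: borel_measurable_diff vG' simp del: of_nat_Suc)
    next
      case 0
      then have "a N j = (\<lambda>_. 0)" by (simp add: fun_eq_iff a_def delayed_increment_def)
      then show ?thesis by simp
    qed
    have law: "distr M borel (\<xi> N i) = gaussian (1 / N)" if "i < N" for i
      using distributed_distr_eq_density[OF dis[OF that]]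
      by (simp add: gaussian_def cong: distr_cong)
    have "expectation (\<lambda>\<omega>. F N (\<lambda>j. if j < N then a N j \<omega> + \<xi> N j \<omega> else 0)) \<le>
      ln (expectation (\<lambda>\<omega>. exp (F N (\<lambda>j. if j < N then \<xi> N j \<omega> else 0)))) +
      (\<Sum>i<N. expectation (\<lambda>\<omega>. (norm (a N i \<omega>))\<^sup>2) / (2 * (1 / N)))"
    proof (rule discrete_variational_bound[where G=G])
      \<comment> \<open>\<open>indep_set\<close> includes that both families consist of events,
        which yields the inclusion of \<open>G i\<close> in \<open>M\<close>.\<close>
      show "subalgebra M (G i)" if "i < N" for i
        using indep_setD_ev1[OF ind[OF that]] by (simp add: subalgebra_def G_def)
      show "\<bar>F N y\<bar> \<le> C" for y unfolding F_def by (rule C)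
    qed (use N FM \<xi>M \<xi>G aG ind law int_a in auto)
    \<comment> \<open>The increments have variance \<open>1 / N\<close> per coordinate, so dividing
      by \<open>2 * (1 / N)\<close> gives the weight \<open>N / 2\<close> that the grid energy bound
      expects.\<close>
    also have "(\<Sum>i<N. expectation (\<lambda>\<omega>. (norm (a N i \<omega>))\<^sup>2) / (2 * (1 / N))) =
        expectation (\<lambda>\<omega>. real N * (\<Sum>j<N. (norm (a N j \<omega>))\<^sup>2)) / 2"
      using int_a by (simp add: Bochner_Integration.integral_sum sum_distrib_left sum_divide_distrib mult.commute)
    also have "expectation (\<lambda>\<omega>. real N * (\<Sum>j<N. (norm (a N j \<omega>))\<^sup>2)) \<le> expectation K"
      using energy[OF N] int_a by (intro integral_mono_AE K) auto
    finally show ?thesis by simp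
  qed
  have AE: "AE \<omega> in M. (\<lambda>N. F N (\<lambda>j. if j < N then \<xi> N j \<omega> else 0)) \<longlonglongrightarrow> \<Phi> (\<lambda>t\<in>{0..1}. \<beta> \<omega> t) \<and>
      (\<lambda>N. F N (\<lambda>j. if j < N then a N j \<omega> + \<xi> N j \<omega> else 0)) \<longlonglongrightarrow> \<Phi> (path_add (\<beta> \<omega>) (v \<omega>))"
    using cm \<beta>0 AE_space
  proof eventually_elim
    case (elim \<omega>)
    then obtain h d where h: "cm_density h d" "\<And>t. t \<in> {0..1} \<Longrightarrow> v \<omega> t = h t" by auto
    have "h 0 = (LINT s:{0}|lborel. d s)" using h(1) by (simp add: cm_density_def)
    also have "\<dots> = 0"
      unfolding set_lebesgue_integral_def
      by (rule integral_eq_zero_AE) (use AE_lborel_singleton[of "0::real"] in eventually_elim, auto)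
    finally have "h 0 = 0" .
    then have v0: "v \<omega> 0 = 0" using h(2)[of 0] by simp
    have vc: "continuous_on {0..1} (v \<omega>)"
      by (rule continuous_on_eq[OF cm_density_continuous[OF h(1)]]) (simp add: h(2))
    have bc: "continuous_on {0..1} (\<beta> \<omega>)"
      using measurable_space[OF \<beta>M elim(3)] by (simp add: path_space_def space_restrict_space)
    note lim = grid_path_converges[OF bc elim(2) vc v0]
    show ?case
      unfolding F_def \<xi>_def a_def
      by (intro conjI \<Phi>cont) (use lim in \<open>simp_all add: path_add_def\<close>)
  qed
  have FXM: "(\<lambda>\<omega>. F N (\<lambda>j. if j < N then \<xi> N j \<omega> else 0)) \<in> borel_measurable M"
    and FYM: "(\<lambda>\<omega>. F N (\<lambda>j. if j < N then a N j \<omega> + \<xi> N j \<omega> else 0)) \<in> borel_measurable M" for N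
    using \<xi>M aM
    by (auto intro!: measurable_compose[OF measurable_seq_truncate FM] borel_measurable_add)
  have \<Phi>X: "(\<lambda>\<omega>. \<Phi> (\<lambda>t\<in>{0..1}. \<beta> \<omega> t)) \<in> borel_measurable M"
    by (rule measurable_compose[OF measurable_restrict \<Phi>M]) (rule \<beta>eval)
  have \<Phi>Y: "(\<lambda>\<omega>. \<Phi> (path_add (\<beta> \<omega>) (v \<omega>))) \<in> borel_measurable M"
    unfolding path_add_def
    by (rule measurable_compose[OF measurable_restrict \<Phi>M]) (intro borel_measurable_add \<beta>eval vM)
  have limY: "(\<lambda>N. expectation (\<lambda>\<omega>. F N (\<lambda>j. if j < N then a N j \<omega> + \<xi> N j \<omega> else 0)))
      \<longlonglongrightarrow> expectation (\<lambda>\<omega>. \<Phi> (path_add (\<beta> \<omega>) (v \<omega>)))"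
    by (rule integral_dominated_convergence[where w="\<lambda>_. C"])
      (use AE FYM \<Phi>Y C in \<open>auto simp: F_def elim: eventually_mono\<close>)
  have "(\<lambda>N. expectation (\<lambda>\<omega>. exp (F N (\<lambda>j. if j < N then \<xi> N j \<omega> else 0))))
      \<longlonglongrightarrow> expectation (\<lambda>\<omega>. exp (\<Phi> (\<lambda>t\<in>{0..1}. \<beta> \<omega> t)))"
  proof (rule integral_dominated_convergence[where w="\<lambda>_. exp C"])
    show "AE \<omega> in M. (\<lambda>N. exp (F N (\<lambda>j. if j < N then \<xi> N j \<omega> else 0))) \<longlonglongrightarrow> exp (\<Phi> (\<lambda>t\<in>{0..1}. \<beta> \<omega> t))"
      using AE by eventually_elim (auto intro: tendsto_exp)
    show "AE \<omega> in M. norm (exp (F N (\<lambda>j. if j < N then \<xi> N j \<omega> else 0))) \<le> exp C" for N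
      using C by (auto simp: F_def abs_le_iff)
  qed (use FXM \<Phi>X in auto)
  moreover have "0 < expectation (\<lambda>\<omega>. exp (\<Phi> (\<lambda>t\<in>{0..1}. \<beta> \<omega> t)))"
    using exp_bound_integral(2)[OF \<Phi>X C] exp_gt_zero[of "- C"] by linarith
  ultimately have limX: "(\<lambda>N. ln (expectation (\<lambda>\<omega>. exp (F N (\<lambda>j. if j < N then \<xi> N j \<omega> else 0)))) + expectation K / 2)
      \<longlonglongrightarrow> ln (expectation (\<lambda>\<omega>. exp (\<Phi> (\<lambda>t\<in>{0..1}. \<beta> \<omega> t)))) + expectation K / 2"
    by (intro tendsto_intros) auto
  show ?thesis
    by (rule tendsto_le[OF _ limX limY]) (use discrete in \<open>auto intro: eventually_sequentiallyI[of 1]\<close>)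
qed


section \<open>Approximation of measurable functionals\<close>

lemma test_functional_const: "test_functional (\<lambda>_. c)"
  by (auto simp: test_functional_def)

lemma test_functional_bin:
  assumes "test_functional \<Phi>" "test_functional \<Psi>"
  shows test_functional_add: "test_functional (\<lambda>x. \<Phi> x + \<Psi> x)"
    and test_functional_diff: "test_functional (\<lambda>x. \<Phi> x - \<Psi> x)"
    and test_functional_max: "test_functional (\<lambda>x. max (\<Phi> x) (\<Psi> x))"
    and test_functional_min: "test_functional (\<lambda>x. min (\<Phi> x) (\<Psi> x))"
proof -
  obtain C D where CD: "\<And>x. \<bar>\<Phi> x\<bar> \<le> C" "\<And>x. \<bar>\<Psi> x\<bar> \<le> D"
    using assms unfolding test_functional_def by metis
  have 1: "\<bar>\<Phi> x + \<Psi> x\<bar> \<le> C + D" "\<bar>\<Phi> x - \<Psi> x\<bar> \<le> C + D"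
    "\<bar>max (\<Phi> x) (\<Psi> x)\<bar> \<le> C + D" "\<bar>min (\<Phi> x) (\<Psi> x)\<bar> \<le> C + D" for x
    using CD[of x] by linarith+
  have meas: "\<Phi> \<in> borel_measurable (PiM {0..1} (\<lambda>_. borel))" "\<Psi> \<in> borel_measurable (PiM {0..1} (\<lambda>_. borel))"
    using assms by (auto simp: test_functional_def)
  show "test_functional (\<lambda>x. \<Phi> x + \<Psi> x)"
    unfolding test_functional_def using assms meas
    by (intro conjI exI[of _ "C + D"] allI 1 impI tendsto_intros) (auto simp: test_functional_def)
  show "test_functional (\<lambda>x. \<Phi> x - \<Psi> x)"
    unfolding test_functional_def using assms meas
    by (intro conjI exI[of _ "C + D"] allI 1 impI tendsto_intros) (auto simp: test_functional_def)
  show "test_functional (\<lambda>x. max (\<Phi> x) (\<Psi> x))"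
    unfolding test_functional_def using assms meas
    by (intro conjI exI[of _ "C + D"] allI 1 impI tendsto_max) (auto simp: test_functional_def)
  show "test_functional (\<lambda>x. min (\<Phi> x) (\<Psi> x))"
    unfolding test_functional_def using assms meas
    by (intro conjI exI[of _ "C + D"] allI 1 impI tendsto_min) (auto simp: test_functional_def)
qed

lemma test_functional_cmult:
  assumes "test_functional \<Phi>"
  shows "test_functional (\<lambda>x. c * \<Phi> x)"
proof -
  obtain C where C: "\<And>x. \<bar>\<Phi> x\<bar> \<le> C"
    using assms unfolding test_functional_def by metis
  have 1: "\<bar>c * \<Phi> x\<bar> \<le> \<bar>c\<bar> * C" for x
    unfolding abs_mult by (intro mult_left_mono C) auto
  show ?thesis
    unfolding test_functional_def using assms
    by (intro conjI exI[of _ "\<bar>c\<bar> * C"] allI 1 impI tendsto_intros) (auto simp: test_functional_def)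
qed

lemma test_functional_eval:
  fixes g :: "real ^ 'n \<Rightarrow> real"
  assumes s: "s \<in> {0..1}" and g: "continuous_on UNIV g" and C: "\<And>y. \<bar>g y\<bar> \<le> C"
  shows "test_functional (\<lambda>x. g (x s))"
  unfolding test_functional_def
proof (intro conjI exI[of _ C] allI C impI)
  show "(\<lambda>x. g (x s)) \<in> borel_measurable (PiM {0..1} (\<lambda>_. borel))"
    by (rule measurable_compose[OF measurable_component_singleton[OF s] borel_measurable_continuous_onI[OF g]])
  show "(\<lambda>k. g (X k s)) \<longlonglongrightarrow> g (x s)" if "\<forall>t\<in>{0..1}. (\<lambda>k. X k t) \<longlonglongrightarrow> x t" for X x
    using that s by (intro tendsto_continuous_seq[OF g]) auto
qed

text \<open>\<open>UNIV\<close> is excluded because \<open>infdist\<close> to the empty set is 0,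
  which would make the limit 0.\<close>

lemma open_infdist_limit:
  fixes U :: "'b::metric_space set"
  assumes "open U" "U \<noteq> UNIV"
  shows "(\<lambda>k. min 1 (real k * infdist x (- U))) \<longlonglongrightarrow> indicator U x"
proof (cases "x \<in> U")
  case True
  then have "infdist x (- U) > 0"
    using assms in_closed_iff_infdist_zero[of "- U" x] infdist_nonneg[of x "- U"]
    by (auto simp: closed_Compl less_le)
  then have lim: "filterlim (\<lambda>k. real k * infdist x (- U)) at_top sequentially"
    by (intro filterlim_at_top_mult_tendsto_pos[OF tendsto_const] filterlim_real_sequentially)
  have "eventually (\<lambda>k. min 1 (real k * infdist x (- U)) = indicator U x) sequentially"
    using filterlim_at_top_dense[THEN iffD1, OF lim, rule_format, of 1]
    by eventually_elim (use True in auto)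
  then show ?thesis by (rule tendsto_eventually)
qed (simp add: infdist_zero)

text \<open>This is membership in the L^1-closure of the test functionals of
  \<open>b\<close>.\<close>

definition approximable :: "'a measure \<Rightarrow> ('a \<Rightarrow> real \<Rightarrow> real ^ 'n) \<Rightarrow> ('a \<Rightarrow> real) \<Rightarrow> bool" where
  "approximable M b h \<longleftrightarrow> integrable M h \<and>
     (\<forall>e>0. \<exists>\<Phi>. test_functional \<Phi> \<and> (\<integral>\<omega>. \<bar>h \<omega> - \<Phi> (b \<omega>)\<bar> \<partial>M) < e)"

locale path_valued = prob_space M for M :: "'a measure" +
  fixes b :: "'a \<Rightarrow> real \<Rightarrow> real ^ 'n"
  assumes b [measurable]: "b \<in> M \<rightarrow>\<^sub>M PiM {0..1} (\<lambda>_. borel)"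
begin

lemma integrable_test_functional:
  assumes "test_functional \<Phi>"
  shows "integrable M (\<lambda>\<omega>. \<Phi> (b \<omega>))"
proof -
  obtain C where C: "\<And>x. \<bar>\<Phi> x\<bar> \<le> C" and [measurable]: "\<Phi> \<in> borel_measurable (PiM {0..1} (\<lambda>_. borel))"
    using assms unfolding test_functional_def by metis
  show ?thesis
    by (intro integrable_const_bound[where B=C] AE_I2) (use C in auto)
qed

lemma approximable_test_functional:
  assumes "test_functional \<Phi>"
  shows "approximable M b (\<lambda>\<omega>. \<Phi> (b \<omega>))"
  unfolding approximable_def using assms integrable_test_functional[OF assms]
  by (auto intro!: exI[of _ \<Phi>])

text \<open>One argument for sum, difference and maximum: each is Lipschitz with constant 1 in the
  sum of the two distances and preserves test functionals.\<close>

lemma approximable_bin: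
  assumes f: "approximable M b f" and g: "approximable M b g"
    and int: "integrable M (\<lambda>\<omega>. B (f \<omega>) (g \<omega>))"
    and lip: "\<And>x y x' y'. \<bar>B x y - B x' y'\<bar> \<le> \<bar>x - x'\<bar> + \<bar>y - y'\<bar>"
    and tf: "\<And>\<Phi> \<Psi> :: (real \<Rightarrow> real ^ 'n) \<Rightarrow> real. test_functional \<Phi> \<Longrightarrow> test_functional \<Psi> \<Longrightarrow> test_functional (\<lambda>x. B (\<Phi> x) (\<Psi> x))"
  shows "approximable M b (\<lambda>\<omega>. B (f \<omega>) (g \<omega>))"
  unfolding approximable_def
proof (intro conjI int allI impI)
  fix e :: real assume "e > 0"
  then have "e / 2 > 0" by simp
  then obtain \<Phi> \<Psi> where \<Phi>: "test_functional \<Phi>" "(\<integral>\<omega>. \<bar>f \<omega> - \<Phi> (b \<omega>)\<bar> \<partial>M) < e / 2"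
    and \<Psi>: "test_functional \<Psi>" "(\<integral>\<omega>. \<bar>g \<omega> - \<Psi> (b \<omega>)\<bar> \<partial>M) < e / 2"
    using f g unfolding approximable_def by metis
  note ints = integrable_test_functional[OF \<Phi>(1)] integrable_test_functional[OF \<Psi>(1)]
    integrable_test_functional[OF tf[OF \<Phi>(1) \<Psi>(1)]]
  have fg: "integrable M f" "integrable M g" using f g by (auto simp: approximable_def)
  have "(\<integral>\<omega>. \<bar>B (f \<omega>) (g \<omega>) - B (\<Phi> (b \<omega>)) (\<Psi> (b \<omega>))\<bar> \<partial>M) \<le>
      (\<integral>\<omega>. \<bar>f \<omega> - \<Phi> (b \<omega>)\<bar> + \<bar>g \<omega> - \<Psi> (b \<omega>)\<bar> \<partial>M)"
    using ints fg int by (intro integral_mono lip) auto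
  also have "\<dots> < e" using ints fg \<Phi>(2) \<Psi>(2) by simp
  finally show "\<exists>\<Theta>. test_functional \<Theta> \<and> (\<integral>\<omega>. \<bar>B (f \<omega>) (g \<omega>) - \<Theta> (b \<omega>)\<bar> \<partial>M) < e"
    using tf[OF \<Phi>(1) \<Psi>(1)] by blast
qed

lemma approximable_add:
  assumes "approximable M b f" "approximable M b g"
  shows "approximable M b (\<lambda>\<omega>. f \<omega> + g \<omega>)"
  by (rule approximable_bin[where B="(+)", OF assms _ _ test_functional_add])
    (use assms in \<open>auto simp: approximable_def\<close>)

lemma approximable_max:
  assumes "approximable M b f" "approximable M b g"
  shows "approximable M b (\<lambda>\<omega>. max (f \<omega>) (g \<omega>))"
  by (rule approximable_bin[where B="max", OF assms _ _ test_functional_max])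
    (use assms in \<open>auto simp: approximable_def\<close>)

lemma approximable_diff:
  assumes "approximable M b f" "approximable M b g"
  shows "approximable M b (\<lambda>\<omega>. f \<omega> - g \<omega>)"
  by (rule approximable_bin[where B="(-)", OF assms _ _ test_functional_diff])
    (use assms in \<open>auto simp: approximable_def\<close>)

lemma approximable_cmult:
  assumes f: "approximable M b f"
  shows "approximable M b (\<lambda>\<omega>. c * f \<omega>)"
  unfolding approximable_def
proof (intro conjI allI impI)
  show "integrable M (\<lambda>\<omega>. c * f \<omega>)" using f by (simp add: approximable_def)
  fix e :: real assume "e > 0"
  then have "e / (\<bar>c\<bar> + 1) > 0" by simp
  then obtain \<Phi> where \<Phi>: "test_functional \<Phi>" "(\<integral>\<omega>. \<bar>f \<omega> - \<Phi> (b \<omega>)\<bar> \<partial>M) < e / (\<bar>c\<bar> + 1)"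
    using f unfolding approximable_def by metis
  have "(\<integral>\<omega>. \<bar>c * f \<omega> - c * \<Phi> (b \<omega>)\<bar> \<partial>M) = \<bar>c\<bar> * (\<integral>\<omega>. \<bar>f \<omega> - \<Phi> (b \<omega>)\<bar> \<partial>M)"
    by (simp flip: right_diff_distrib add: abs_mult)
  also have "\<dots> \<le> (\<bar>c\<bar> + 1) * (\<integral>\<omega>. \<bar>f \<omega> - \<Phi> (b \<omega>)\<bar> \<partial>M)"
    by (intro mult_right_mono integral_nonneg_AE) auto
  also have "\<dots> < e" using \<Phi>(2) by (simp add: pos_less_divide_eq mult.commute)
  finally show "\<exists>\<Theta>. test_functional \<Theta> \<and> (\<integral>\<omega>. \<bar>c * f \<omega> - \<Theta> (b \<omega>)\<bar> \<partial>M) < e"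
    using test_functional_cmult[OF \<Phi>(1)] by blast
qed

text \<open>An L^1-closure is closed under dominated limits. With a constant sequence the lemma also
  replaces a function by an almost everywhere equal one.\<close>

lemma approximable_lim:
  assumes s: "\<And>k::nat. approximable M b (s k)" and h: "h \<in> borel_measurable M" and w: "integrable M w"
    and lim: "AE \<omega> in M. (\<lambda>k. s k \<omega>) \<longlonglongrightarrow> h \<omega>" and bound: "\<And>k. AE \<omega> in M. \<bar>s k \<omega>\<bar> \<le> w \<omega>"
  shows "approximable M b h"
  unfolding approximable_def
proof (intro conjI allI impI)
  have ints: "integrable M (s k)" for k using s by (simp add: approximable_def)
  have sm: "s k \<in> borel_measurable M" for k using ints by auto
  show int: "integrable M h"
    by (rule integrable_dominated_convergence[OF h sm w lim]) (use bound in simp)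
  fix e :: real assume e: "e > 0"
  have "(\<lambda>k. \<integral>\<omega>. \<bar>h \<omega> - s k \<omega>\<bar> \<partial>M) \<longlonglongrightarrow> (\<integral>\<omega>. 0 \<partial>M)"
  proof (rule integral_dominated_convergence[where w="\<lambda>\<omega>. \<bar>h \<omega>\<bar> + w \<omega>"])
    show "AE \<omega> in M. (\<lambda>k. \<bar>h \<omega> - s k \<omega>\<bar>) \<longlonglongrightarrow> 0"
      using lim
    proof eventually_elim
      case (elim \<omega>)
      have "(\<lambda>k. \<bar>h \<omega> - s k \<omega>\<bar>) \<longlonglongrightarrow> \<bar>h \<omega> - h \<omega>\<bar>" by (intro tendsto_intros elim)
      then show ?case by simp
    qed
    show "AE \<omega> in M. norm \<bar>h \<omega> - s k \<omega>\<bar> \<le> \<bar>h \<omega>\<bar> + w \<omega>" for k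
      using bound[of k] by eventually_elim auto
  qed (use int w h sm in auto)
  then have "eventually (\<lambda>k. (\<integral>\<omega>. \<bar>h \<omega> - s k \<omega>\<bar> \<partial>M) < e / 2) sequentially"
    using e by (intro order_tendstoD(2)[of _ 0]) auto
  then obtain k where k: "(\<integral>\<omega>. \<bar>h \<omega> - s k \<omega>\<bar> \<partial>M) < e / 2"
    by (auto simp: eventually_sequentially)
  from e have "e / 2 > 0" by simp
  then obtain \<Phi> where \<Phi>: "test_functional \<Phi>" "(\<integral>\<omega>. \<bar>s k \<omega> - \<Phi> (b \<omega>)\<bar> \<partial>M) < e / 2"
    using s[of k] unfolding approximable_def by metis
  have "(\<integral>\<omega>. \<bar>h \<omega> - \<Phi> (b \<omega>)\<bar> \<partial>M) \<le> (\<integral>\<omega>. \<bar>h \<omega> - s k \<omega>\<bar> + \<bar>s k \<omega> - \<Phi> (b \<omega>)\<bar> \<partial>M)"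
    using int ints[of k] integrable_test_functional[OF \<Phi>(1)] by (intro integral_mono) auto
  also have "\<dots> < e"
    using int ints[of k] integrable_test_functional[OF \<Phi>(1)] k \<Phi>(2) by simp
  finally show "\<exists>\<Phi>. test_functional \<Phi> \<and> (\<integral>\<omega>. \<bar>h \<omega> - \<Phi> (b \<omega>)\<bar> \<partial>M) < e"
    using \<Phi>(1) by blast
qed

definition approximable_sets :: "'a set set" where
  "approximable_sets = {A \<in> sets M. approximable M b (indicator A)}"

lemma sigma_algebra_approximable_sets: "sigma_algebra (space M) approximable_sets"
  unfolding sigma_algebra_iff2
proof (intro conjI ballI allI impI)
  show "approximable_sets \<subseteq> Pow (space M)"
    using sets.sets_into_space by (auto simp: approximable_sets_def)
  have const: "approximable M b (\<lambda>_. c)" for c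
    using approximable_test_functional[OF test_functional_const] .
  show empty: "{} \<in> approximable_sets"
  proof -
    have "indicator {} = (\<lambda>_::'a. 0::real)" by (simp add: fun_eq_iff)
    then show ?thesis using const[of 0] by (simp add: approximable_sets_def)
  qed
  show "space M - A \<in> approximable_sets" if "A \<in> approximable_sets" for A
  proof -
    have "approximable M b (\<lambda>\<omega>. 1 - indicator A \<omega>)"
      using that const by (intro approximable_diff) (auto simp: approximable_sets_def)
    \<comment> \<open>Used with a constant sequence: the indicator of the complement agrees with
      \<open>1 - indicator A \<omega>\<close> only on \<open>space M\<close>.\<close>
    from approximable_lim[OF this, of "indicator (space M - A)" "\<lambda>_. 1"] show ?thesis
      using that by (auto simp: approximable_sets_def indicator_def)
  qed
  fix A :: "nat \<Rightarrow> 'a set" assume A: "range A \<subseteq> approximable_sets"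
  \<comment> \<open>Finite unions correspond to maxima of indicators; the countable union is then a
    dominated limit of these.\<close>
  have un: "(\<Union>i<k. A i) \<in> approximable_sets" for k
  proof (induction k)
    case (Suc k)
    have "approximable M b (\<lambda>\<omega>. max (indicator (\<Union>i<k. A i) \<omega>) (indicator (A k) \<omega>))"
      using Suc A by (intro approximable_max) (auto simp: approximable_sets_def)
    also have "(\<lambda>\<omega>. max (indicator (\<Union>i<k. A i) \<omega>) (indicator (A k) \<omega>)) =
        (indicator (\<Union>i<Suc k. A i) :: 'a \<Rightarrow> real)"
      by (rule ext) (auto simp: lessThan_Suc split: split_indicator)
    finally show ?case using Suc A by (auto simp: approximable_sets_def)
  qed (use empty in simp)
  have sets: "(\<Union>i. A i) \<in> sets M" using A by (auto simp: approximable_sets_def)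
  have "approximable M b (indicator (\<Union>i. A i))"
  proof (rule approximable_lim)
    show "approximable M b (indicator (\<Union>i<k. A i))" for k
      using un by (simp add: approximable_sets_def)
    show "AE \<omega> in M. (\<lambda>k. indicator (\<Union>i<k. A i) \<omega>) \<longlonglongrightarrow> indicat_real (\<Union>i. A i) \<omega>"
      by (intro AE_I2 LIMSEQ_indicator_UN)
    show "integrable M (\<lambda>_. 1::real)" by simp
  qed (use sets in auto)
  then show "(\<Union>i. A i) \<in> approximable_sets" using sets by (simp add: approximable_sets_def)
qed

text \<open>Open sets suffice for Borel measurability, and the indicator of an open set is a bounded
  pointwise limit of continuous functions of the value at \<open>s\<close>.\<close>

lemma approximable_sets_eval:
  assumes s: "s \<in> {0..1}" and B: "B \<in> sets borel"
  shows "(\<lambda>\<omega>. b \<omega> s) -` B \<inter> space M \<in> approximable_sets"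
proof -
  interpret S: sigma_algebra "space M" approximable_sets by (rule sigma_algebra_approximable_sets)
  have meas: "(\<lambda>\<omega>. b \<omega> s) \<in> borel_measurable M"
    using measurable_compose[OF b measurable_component_singleton[OF s]] .
  have "(\<lambda>\<omega>. b \<omega> s) \<in> borel_measurable (sigma (space M) approximable_sets)"
  proof (rule borel_measurableI)
    fix U :: "(real ^ 'n) set" assume U: "open U"
    have "(\<lambda>\<omega>. b \<omega> s) -` U \<inter> space M \<in> approximable_sets"
    proof (cases "U = UNIV")
      case False
      let ?A = "(\<lambda>\<omega>. b \<omega> s) -` U \<inter> space M"
      have A: "?A \<in> sets M" using measurable_sets[OF meas, of U] U by simp
      have "approximable M b (indicator ?A)"
      proof (rule approximable_lim)
        show "approximable M b (\<lambda>\<omega>. min 1 (real k * infdist (b \<omega> s) (- U)))" for k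
          by (intro approximable_test_functional test_functional_eval[OF s, where C=1] continuous_intros)
            (auto simp: infdist_nonneg abs_le_iff min_def intro: order_trans[of _ 0])
        show "AE \<omega> in M. (\<lambda>k. min 1 (real k * infdist (b \<omega> s) (- U))) \<longlonglongrightarrow> indicat_real ?A \<omega>"
          using open_infdist_limit[OF U False] by (auto simp: indicator_def)
        show "AE \<omega> in M. \<bar>min 1 (real k * infdist (b \<omega> s) (- U))\<bar> \<le> 1" for k
          by (auto simp: infdist_nonneg abs_le_iff min_def intro: order_trans[of _ 0])
      qed (use A in auto)
      then show ?thesis using A by (simp add: approximable_sets_def)
    qed simp
    then show "(\<lambda>\<omega>. b \<omega> s) -` U \<inter> space (sigma (space M) approximable_sets)
        \<in> sets (sigma (space M) approximable_sets)"
      by simp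
  qed
  from measurable_sets[OF this B] show ?thesis by simp
qed

text \<open>Density of test functionals in L^1. Coordinate events are approximable, null sets are
  approximated by the functional 0, and approximable events form a sigma-algebra, hence all events
  qualify; induction extends this from indicators to integrable functions.\<close>

lemma approximable_integrable:
  assumes gen: "sets M = sigma_sets (space M)
      ({(\<lambda>\<omega>. b \<omega> s) -` B \<inter> space M | s B. s \<in> {0..1} \<and> B \<in> sets borel} \<union> \<N>)"
    and null: "\<N> \<subseteq> null_sets M" and h: "integrable M h"
  shows "approximable M b h"
  using h
proof (induction rule: integrable_induct)
  case (base A c)
  interpret S: sigma_algebra "space M" approximable_sets by (rule sigma_algebra_approximable_sets)
  have "N \<in> approximable_sets" if "N \<in> \<N>" for N
  proof -
    have N: "N \<in> null_sets M" using that null by auto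
    have "approximable M b (indicator N)"
    proof (rule approximable_lim[of "\<lambda>_ _. 0" _ "\<lambda>_. 0"])
      show "AE \<omega> in M. (\<lambda>_. 0) \<longlonglongrightarrow> indicat_real N \<omega>"
        using AE_not_in[OF N] by eventually_elim simp
    qed (use N approximable_test_functional[OF test_functional_const, of 0] in auto)
    then show ?thesis using N by (auto simp: approximable_sets_def)
  qed
  then have "sets M \<subseteq> approximable_sets"
    unfolding gen using approximable_sets_eval by (intro S.sigma_sets_subset) auto
  then have "approximable M b (\<lambda>\<omega>. c * indicator A \<omega>)"
    using base by (intro approximable_cmult) (auto simp: approximable_sets_def)
  then show ?case by (simp add: mult.commute)
next
  case (add f g)
  then show ?case by (intro approximable_add) auto
next
  case (lim f s)
  show ?case
    by (rule approximable_lim[of s f "\<lambda>\<omega>. 2 * \<bar>f \<omega>\<bar>"]) (use lim in auto)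
qed

text \<open>Clamping the approximants to \<open>[- C, C]\<close> does not move them away from
  \<open>h\<close>, whose values lie there. A subsequence of an L^1-convergent sequence converges
  almost everywhere.\<close>

lemma approximating_sequence:
  assumes h: "approximable M b h" and C: "\<And>\<omega>. \<bar>h \<omega>\<bar> \<le> C"
  obtains \<Phi> :: "nat \<Rightarrow> _" where "\<And>k. test_functional (\<Phi> k)" "\<And>k x. \<bar>\<Phi> k x\<bar> \<le> C"
    "AE \<omega> in M. (\<lambda>k. \<Phi> k (b \<omega>)) \<longlonglongrightarrow> h \<omega>"
proof -
  have C0: "C \<ge> 0" using C[of undefined] by simp
  have "\<exists>\<Phi>. test_functional \<Phi> \<and> (\<integral>\<omega>. \<bar>h \<omega> - \<Phi> (b \<omega>)\<bar> \<partial>M) < 1 / real (Suc k)" for k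
    using h unfolding approximable_def by simp
  then obtain \<Psi> where \<Psi>: "\<And>k. test_functional (\<Psi> k)"
    "\<And>k. (\<integral>\<omega>. \<bar>h \<omega> - \<Psi> k (b \<omega>)\<bar> \<partial>M) < 1 / real (Suc k)" by metis
  define \<Phi> where "\<Phi> k x = max (- C) (min C (\<Psi> k x))" for k x
  have tf: "test_functional (\<Phi> k)" for k
    unfolding \<Phi>_def by (intro test_functional_max test_functional_min test_functional_const \<Psi>(1))
  have hint: "integrable M h" using h by (simp add: approximable_def)
  have le: "(\<integral>\<omega>. norm (h \<omega> - \<Phi> k (b \<omega>)) \<partial>M) \<le> 1 / real (Suc k)" for k
  proof -
    have "(\<integral>\<omega>. norm (h \<omega> - \<Phi> k (b \<omega>)) \<partial>M) \<le> (\<integral>\<omega>. \<bar>h \<omega> - \<Psi> k (b \<omega>)\<bar> \<partial>M)"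
    proof (rule integral_mono)
      fix \<omega> show "norm (h \<omega> - \<Phi> k (b \<omega>)) \<le> \<bar>h \<omega> - \<Psi> k (b \<omega>)\<bar>"
        using C[of \<omega>] unfolding \<Phi>_def real_norm_def by (auto simp: max_def min_def)
    qed (intro integrable_norm integrable_abs Bochner_Integration.integrable_diff hint
        integrable_test_functional tf \<Psi>(1))+
    then show ?thesis using \<Psi>(2)[of k] by linarith
  qed
  have "(\<lambda>k. 1 / real (Suc k)) \<longlonglongrightarrow> 0"
    using LIMSEQ_inverse_real_of_nat by (simp add: inverse_eq_divide)
  from tendsto_sandwich[OF _ _ tendsto_const this, of "\<lambda>k. \<integral>\<omega>. norm (h \<omega> - \<Phi> k (b \<omega>)) \<partial>M"]
  have "(\<lambda>k. \<integral>\<omega>. norm (h \<omega> - \<Phi> k (b \<omega>)) \<partial>M) \<longlonglongrightarrow> 0"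
    using le by (simp add: integral_nonneg_AE)
  then obtain r where r: "AE \<omega> in M. (\<lambda>k. h \<omega> - \<Phi> (r k) (b \<omega>)) \<longlonglongrightarrow> 0"
    using tendsto_L1_AE_subseq[of M "\<lambda>k \<omega>. h \<omega> - \<Phi> k (b \<omega>)"]
      Bochner_Integration.integrable_diff[OF hint integrable_test_functional[OF tf]] by blast
  have "AE \<omega> in M. (\<lambda>k. \<Phi> (r k) (b \<omega>)) \<longlonglongrightarrow> h \<omega>"
    using r
  proof eventually_elim
    case (elim \<omega>)
    from tendsto_diff[OF tendsto_const elim, of "h \<omega>"] show ?case by simp
  qed
  with tf show thesis
    by (intro that[of "\<lambda>k. \<Phi> (r k)"]) (use C0 in \<open>auto simp: \<Phi>_def abs_le_iff max_def min_def\<close>)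
qed

end


section \<open>The variational lower bound\<close>

lemma null_sets_completion_idem: "null_sets (completion (completion M)) = null_sets (completion M)"
  unfolding set_eq_iff null_sets_completion_iff2[of _ "completion M"]
  using null_sets_completion_subset[of _ _ M] by blast

text \<open>\<open>bm\<close> speaks of \<open>completion \<nu>\<close>, so its filtration adjoins
  the null sets of a double completion; this identifies it with the filtration in
  \<open>bm_filtration\<close>.\<close>

lemma sets_completed_filtration_completion:
  "sets (completed_filtration (completion M) X t) = sets (completed_filtration M X t)"
  by (simp add: sets_completed_filtration null_sets_completion_idem)

text \<open>Approximants converge to \<open>h\<close> only almost everywhere, yet they are evaluated
  along the shifted path. \<open>T_null\<close> carries the convergence to the points
  \<open>T \<omega>\<close>, whose path under \<open>\<beta>\<close> is the shifted one. The common
  bound \<open>C\<close> lets both sides pass to the limit.\<close>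

lemma (in prob_space) bounded_variational_bound:
  fixes \<beta> v :: "'a \<Rightarrow> real \<Rightarrow> real ^ 'n"
  assumes bm: "brownian_motion M \<beta>"
    and vG: "\<And>t. t \<in> {0..1} \<Longrightarrow> (\<lambda>\<omega>. v \<omega> t) \<in> borel_measurable (completed_filtration M \<beta> t)"
    and sets: "sets M = sets (completed_filtration M \<beta> 1)"
    and cm: "AE \<omega> in M. \<exists>h d. cm_density h d \<and> (\<forall>t\<in>{0..1}. v \<omega> t = h t) \<and>
      (LINT r:{0..1}|lborel. (norm (d r))\<^sup>2) \<le> K \<omega>"
    and K: "integrable M K"
    and T: "T \<in> M \<rightarrow>\<^sub>M M" and T_null: "\<And>P. AE \<omega> in M. P \<omega> \<Longrightarrow> AE \<omega> in M. P (T \<omega>)"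
    and \<beta>T: "AE \<omega> in M. \<beta> (T \<omega>) = path_add (\<beta> \<omega>) (v \<omega>)"
    and h: "h \<in> borel_measurable M" and C: "\<And>\<omega>. \<bar>h \<omega>\<bar> \<le> C"
  shows "expectation (\<lambda>\<omega>. h (T \<omega>)) \<le> ln (expectation (\<lambda>\<omega>. exp (h \<omega>))) + expectation K / 2"
proof -
  define b where "b \<omega> = (\<lambda>t\<in>{0..1}. \<beta> \<omega> t)" for \<omega>
  have \<beta>M: "\<beta> \<in> M \<rightarrow>\<^sub>M path_space" using bm by (simp add: brownian_motion_def)
  have bM: "b \<in> M \<rightarrow>\<^sub>M PiM {0..1} (\<lambda>_. borel)"
    unfolding b_def by (intro measurable_restrict measurable_path_eval \<beta>M)
  interpret path_valued M b
    by unfold_locales (rule bM)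
  have vM: "(\<lambda>\<omega>. v \<omega> t) \<in> borel_measurable M" if "t \<in> {0..1}" for t
    using measurable_completed_filtration_mono[OF _ vG[OF that], of 1] that
    by (simp add: measurable_def sets)
  \<comment> \<open>The sigma-algebra of \<open>M\<close> is that of a completed filtration and so
    already contains these sets; they can then serve as the null generators in
    \<open>approximable_integrable\<close>.\<close>
  have null: "null_sets (completion M) \<subseteq> null_sets M"
  proof
    fix A assume A: "A \<in> null_sets (completion M)"
    then have "A \<in> sets M" unfolding sets by (rule null_sets_completed_filtration)
    with A show "A \<in> null_sets M" by (simp add: null_sets_completion_iff)
  qed
  have eval_eq: "(\<lambda>\<omega>. \<beta> \<omega> s) = (\<lambda>\<omega>. b \<omega> s)" if "s \<in> {0..1}" for s
    using that by (simp add: b_def)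
  have setform: "{X s B | s B. s \<in> I \<and> B \<in> J} = (\<Union>s\<in>I. X s ` J)"
    for X :: "real \<Rightarrow> (real ^ 'n) set \<Rightarrow> 'a set" and I J by auto
  have "{(\<lambda>\<omega>. \<beta> \<omega> s) -` B \<inter> space M | s B. s \<in> {0..1} \<and> B \<in> sets borel} =
      {(\<lambda>\<omega>. b \<omega> s) -` B \<inter> space M | s B. s \<in> {0..1} \<and> B \<in> sets borel}"
    unfolding setform by (intro SUP_cong image_cong refl) (simp only: eval_eq)
  then have gen: "sets M = sigma_sets (space M)
      ({(\<lambda>\<omega>. b \<omega> s) -` B \<inter> space M | s B. s \<in> {0..1} \<and> B \<in> sets borel} \<union> null_sets (completion M))"
    unfolding sets sets_completed_filtration by simp
  have hint: "integrable M h"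
    by (intro integrable_const_bound[where B=C] AE_I2 h) (use C in auto)
  obtain \<Phi> where \<Phi>: "\<And>k. test_functional (\<Phi> k)" "\<And>k x. \<bar>\<Phi> k x\<bar> \<le> C"
    "AE \<omega> in M. (\<lambda>k. \<Phi> k (b \<omega>)) \<longlonglongrightarrow> h \<omega>"
    by (rule approximating_sequence[OF approximable_integrable[OF gen null hint] C]) blast
  have \<Phi>M: "\<Phi> k \<in> borel_measurable (PiM {0..1} (\<lambda>_. borel))" for k
    using \<Phi>(1)[of k] by (simp add: test_functional_def)
  have step: "expectation (\<lambda>\<omega>. \<Phi> k (path_add (\<beta> \<omega>) (v \<omega>))) \<le>
      ln (expectation (\<lambda>\<omega>. exp (\<Phi> k (b \<omega>)))) + expectation K / 2" for k
    unfolding b_def by (rule continuous_variational_bound[OF bm vG vM cm K \<Phi>(1)])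
  have \<Phi>v: "(\<lambda>\<omega>. \<Phi> k (path_add (\<beta> \<omega>) (v \<omega>))) \<in> borel_measurable M" for k
    unfolding path_add_def
    by (rule measurable_compose[OF measurable_restrict \<Phi>M])
      (intro borel_measurable_add vM measurable_path_eval[OF _ \<beta>M])
  have \<Phi>b: "(\<lambda>\<omega>. \<Phi> k (b \<omega>)) \<in> borel_measurable M" for k
    using measurable_compose[OF bM \<Phi>M] .
  have "(\<lambda>k. expectation (\<lambda>\<omega>. \<Phi> k (path_add (\<beta> \<omega>) (v \<omega>)))) \<longlonglongrightarrow> expectation (\<lambda>\<omega>. h (T \<omega>))"
  proof (rule integral_dominated_convergence[where w="\<lambda>_. C"])
    show "AE \<omega> in M. (\<lambda>k. \<Phi> k (path_add (\<beta> \<omega>) (v \<omega>))) \<longlonglongrightarrow> h (T \<omega>)"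
      using T_null[OF \<Phi>(3)] \<beta>T
    proof eventually_elim
      case (elim \<omega>)
      have "b (T \<omega>) = path_add (\<beta> \<omega>) (v \<omega>)"
        by (auto simp: b_def elim(2) path_add_def fun_eq_iff)
      with elim(1) show ?case by simp
    qed
  qed (use \<Phi>v \<Phi>(2) measurable_compose[OF T h] in auto)
  moreover have "(\<lambda>k. ln (expectation (\<lambda>\<omega>. exp (\<Phi> k (b \<omega>)))) + expectation K / 2)
      \<longlonglongrightarrow> ln (expectation (\<lambda>\<omega>. exp (h \<omega>))) + expectation K / 2"
  proof (intro tendsto_add tendsto_const tendsto_ln)
    show "(\<lambda>k. expectation (\<lambda>\<omega>. exp (\<Phi> k (b \<omega>)))) \<longlonglongrightarrow> expectation (\<lambda>\<omega>. exp (h \<omega>))"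
    proof (rule integral_dominated_convergence[where w="\<lambda>_. exp C"])
      show "AE \<omega> in M. (\<lambda>k. exp (\<Phi> k (b \<omega>))) \<longlonglongrightarrow> exp (h \<omega>)"
        using \<Phi>(3) by eventually_elim (rule tendsto_exp)
    qed (use \<Phi>b \<Phi>(2) h in \<open>auto simp: abs_le_iff\<close>)
    show "expectation (\<lambda>\<omega>. exp (h \<omega>)) \<noteq> 0"
      using exp_bound_integral(2)[OF h C] exp_gt_zero[of "- C"] by linarith
  qed
  ultimately show ?thesis
    by (rule LIMSEQ_le) (use step in auto)
qed

text \<open>If the positive part of \<open>Y + K\<close> has finite integral, so has that of
  \<open>Y\<close>. The clamped bounds then control the negative part of \<open>Y\<close>, and once
  \<open>Y\<close> is integrable the clamp is removed by dominated convergence.\<close>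

lemma (in prob_space) clamped_variational_bound_imp:
  fixes f Y K :: "'a \<Rightarrow> real"
  assumes f: "f \<in> borel_measurable M" and expf: "integrable M (\<lambda>\<omega>. exp (- f \<omega>))"
    and Y: "Y \<in> borel_measurable M" and K: "integrable M K"
    and bound: "\<And>n::nat. expectation (\<lambda>\<omega>. max (- real n) (min (real n) (- Y \<omega>))) \<le>
      ln (expectation (\<lambda>\<omega>. exp (max (- real n) (min (real n) (- f \<omega>))))) + expectation K"
  shows "ereal (- ln (expectation (\<lambda>\<omega>. exp (- f \<omega>)))) \<le> ereal_expectation M (\<lambda>\<omega>. Y \<omega> + K \<omega>)"
proof (cases "(\<integral>\<^sup>+ \<omega>. ennreal (Y \<omega> + K \<omega>) \<partial>M) = \<infinity>")
  case True
  \<comment> \<open>\<open>\<infinity> - \<infinity> = \<infinity>\<close> in \<open>ereal\<close>, so the negative part does not matter here\<close>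
  then show ?thesis by (simp add: ereal_expectation_def)
next
  case False
  let ?c = "\<lambda>n x. max (- real n) (min (real n) x)"
  define Z where "Z = expectation (\<lambda>\<omega>. exp (- f \<omega>))"
  have Zn: "(\<lambda>n. expectation (\<lambda>\<omega>. exp (?c n (- f \<omega>)))) \<longlonglongrightarrow> Z"
    unfolding Z_def
  proof (rule integral_dominated_convergence[where w="\<lambda>\<omega>. exp (- f \<omega>) + 1"])
    have lim: "(\<lambda>n. ?c n x) \<longlonglongrightarrow> x" for x :: real
    proof (rule tendsto_eventually)
      obtain N where "\<bar>x\<bar> \<le> real N" using real_arch_simple by blast
      then show "eventually (\<lambda>n. ?c n x = x) sequentially"
        by (intro eventually_sequentiallyI[of N]) (auto simp: max_def min_def abs_le_iff)
    qed
    show "AE \<omega> in M. (\<lambda>n. exp (?c n (- f \<omega>))) \<longlonglongrightarrow> exp (- f \<omega>)"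
      by (intro AE_I2 tendsto_exp lim)
    \<comment> \<open>Clamping raises the exponent only below \<open>- real n\<close>, where the
      clamped exponential is at most 1; hence the summand 1 in the dominating function.\<close>
    have "exp (?c n x) \<le> exp x + 1" for n x
    proof (cases "x \<le> - real n")
      case True
      then have "exp (?c n x) \<le> 1" by auto
      then show ?thesis using exp_gt_zero[of x] by linarith
    next
      case False
      then have "exp (?c n x) \<le> exp x" by auto
      then show ?thesis by linarith
    qed
    then show "AE \<omega> in M. norm (exp (?c n (- f \<omega>))) \<le> exp (- f \<omega>) + 1" for n by simp
  qed (use f expf in auto)
  have Zpos: "Z > 0"
  proof -
    have "Z \<noteq> 0"
      unfolding Z_def using integral_nonneg_eq_0_iff_AE[OF expf] AE_False by simp
    then show ?thesis unfolding Z_def by (simp add: integral_nonneg_AE less_le)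
  qed
  have ln_lim: "(\<lambda>n. ln (expectation (\<lambda>\<omega>. exp (?c n (- f \<omega>)))) + expectation K) \<longlonglongrightarrow> ln Z + expectation K"
    using Zn Zpos by (intro tendsto_intros) auto
  have pos: "integrable M (\<lambda>\<omega>. max 0 (Y \<omega>))"
  proof (rule Bochner_Integration.integrable_bound)
    have "integrable M (\<lambda>\<omega>. max 0 (Y \<omega> + K \<omega>))"
    proof (rule integrableI_bounded)
      have "(\<integral>\<^sup>+ \<omega>. ennreal (norm (max 0 (Y \<omega> + K \<omega>))) \<partial>M) = (\<integral>\<^sup>+ \<omega>. ennreal (Y \<omega> + K \<omega>) \<partial>M)"
        by (intro nn_integral_cong) (auto simp: max_def ennreal_neg)
      then show "(\<integral>\<^sup>+ \<omega>. ennreal (norm (max 0 (Y \<omega> + K \<omega>))) \<partial>M) < \<infinity>"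
        using False by (simp add: less_top)
    qed (use Y K in auto)
    then show "integrable M (\<lambda>\<omega>. max 0 (Y \<omega> + K \<omega>) + \<bar>K \<omega>\<bar>)" using K by auto
    show "AE \<omega> in M. norm (max 0 (Y \<omega>)) \<le> norm (max 0 (Y \<omega> + K \<omega>) + \<bar>K \<omega>\<bar>)"
      by (intro AE_I2) (auto simp: max_def)
  qed (use Y in auto)
  have cY: "integrable M (\<lambda>\<omega>. ?c n (- Y \<omega>))" for n
    by (intro integrable_const_bound[where B="real n"] AE_I2) (use Y in auto)
  have neg_part: "integrable M (\<lambda>\<omega>. min (real n) (max 0 (- Y \<omega>)))" for n
    by (intro integrable_const_bound[where B="real n"] AE_I2) (use Y in auto)
  have le: "expectation (\<lambda>\<omega>. min (real n) (max 0 (- Y \<omega>))) \<le>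
      ln (expectation (\<lambda>\<omega>. exp (?c n (- f \<omega>)))) + expectation K + expectation (\<lambda>\<omega>. max 0 (Y \<omega>))" for n
  proof -
    \<comment> \<open>Pointwise: where \<open>Y\<close> is nonnegative the left side is 0 and the
      clamp of \<open>- Y\<close> is at least \<open>- Y\<close>; elsewhere both sides
      agree.\<close>
    have "expectation (\<lambda>\<omega>. min (real n) (max 0 (- Y \<omega>))) \<le> expectation (\<lambda>\<omega>. ?c n (- Y \<omega>) + max 0 (Y \<omega>))"
      using neg_part cY pos by (intro integral_mono) (auto simp: max_def min_def)
    also have "\<dots> = expectation (\<lambda>\<omega>. ?c n (- Y \<omega>)) + expectation (\<lambda>\<omega>. max 0 (Y \<omega>))"
      using cY pos by simp
    finally show ?thesis using bound[of n] by linarith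
  qed
  obtain B where B: "\<And>n. ln (expectation (\<lambda>\<omega>. exp (?c n (- f \<omega>)))) + expectation K \<le> B"
    using convergent_imp_Bseq[OF convergentI[OF ln_lim]] unfolding Bseq_def
    by (metis abs_le_D1 real_norm_def)
  \<comment> \<open>The truncated negative parts have expectations bounded uniformly in
    \<open>n\<close>, so monotone convergence applies. Integrability makes the expectation of
    \<open>Y\<close> genuine and not the default value 0.\<close>
  have "integrable M (\<lambda>\<omega>. max 0 (- Y \<omega>))"
  proof (rule integrableI_bounded)
    have "(\<lambda>n. \<integral>\<^sup>+ \<omega>. ennreal (min (real n) (max 0 (- Y \<omega>))) \<partial>M) \<longlonglongrightarrow> (\<integral>\<^sup>+ \<omega>. ennreal (max 0 (- Y \<omega>)) \<partial>M)"
    proof (rule nn_integral_LIMSEQ)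
      show "incseq (\<lambda>n \<omega>. ennreal (min (real n) (max 0 (- Y \<omega>))))"
        by (auto simp: incseq_def le_fun_def intro!: ennreal_leI)
      show "(\<lambda>n. ennreal (min (real n) (max 0 (- Y \<omega>)))) \<longlonglongrightarrow> ennreal (max 0 (- Y \<omega>))" for \<omega>
      proof (rule tendsto_eventually)
        obtain N where "max 0 (- Y \<omega>) \<le> real N" using real_arch_simple by blast
        then show "eventually (\<lambda>n. ennreal (min (real n) (max 0 (- Y \<omega>))) = ennreal (max 0 (- Y \<omega>))) sequentially"
          by (intro eventually_sequentiallyI[of N]) (auto simp: max_def min_def)
      qed
    qed (use Y in auto)
    moreover have "(\<integral>\<^sup>+ \<omega>. ennreal (min (real n) (max 0 (- Y \<omega>))) \<partial>M) \<le>
        ennreal (B + expectation (\<lambda>\<omega>. max 0 (Y \<omega>)))" for n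
    proof -
      have "(\<integral>\<^sup>+ \<omega>. ennreal (min (real n) (max 0 (- Y \<omega>))) \<partial>M) =
          ennreal (expectation (\<lambda>\<omega>. min (real n) (max 0 (- Y \<omega>))))"
        by (intro nn_integral_eq_integral neg_part) auto
      also have "\<dots> \<le> ennreal (B + expectation (\<lambda>\<omega>. max 0 (Y \<omega>)))"
        using le[of n] B[of n] by (intro ennreal_leI) linarith
      finally show ?thesis .
    qed
    ultimately have "(\<integral>\<^sup>+ \<omega>. ennreal (max 0 (- Y \<omega>)) \<partial>M) \<le> ennreal (B + expectation (\<lambda>\<omega>. max 0 (Y \<omega>)))"
      by (intro LIMSEQ_le_const2) auto
    then show "(\<integral>\<^sup>+ \<omega>. ennreal (norm (max 0 (- Y \<omega>))) \<partial>M) < \<infinity>"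
      by (simp add: le_less_trans)
  qed (use Y in auto)
  with pos have "integrable M (\<lambda>\<omega>. max 0 (Y \<omega>) - max 0 (- Y \<omega>))" by (rule Bochner_Integration.integrable_diff)
  also have "(\<lambda>\<omega>. max 0 (Y \<omega>) - max 0 (- Y \<omega>)) = Y" by (auto simp: max_def)
  finally have Yint: "integrable M Y" .
  have "(\<lambda>n. expectation (\<lambda>\<omega>. ?c n (- Y \<omega>))) \<longlonglongrightarrow> expectation (\<lambda>\<omega>. - Y \<omega>)"
  proof (rule integral_dominated_convergence[where w="\<lambda>\<omega>. \<bar>Y \<omega>\<bar>"])
    show "AE \<omega> in M. (\<lambda>n. ?c n (- Y \<omega>)) \<longlonglongrightarrow> - Y \<omega>"
    proof (intro AE_I2 tendsto_eventually)
      fix \<omega>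
      obtain N where "\<bar>Y \<omega>\<bar> \<le> real N" using real_arch_simple by blast
      then show "eventually (\<lambda>n. ?c n (- Y \<omega>) = - Y \<omega>) sequentially"
        by (intro eventually_sequentiallyI[of N]) (auto simp: max_def min_def abs_le_iff)
    qed
  qed (use Y Yint in \<open>auto simp: max_def min_def\<close>)
  then have "expectation (\<lambda>\<omega>. - Y \<omega>) \<le> ln Z + expectation K"
    using ln_lim bound by (intro LIMSEQ_le[OF _ ln_lim]) auto
  then have le: "- ln Z \<le> expectation (\<lambda>\<omega>. Y \<omega> + K \<omega>)"
    using Yint K by simp
  have int: "integrable M (\<lambda>\<omega>. Y \<omega> + K \<omega>)" using Yint K by simp
  have part: "(\<integral>\<^sup>+ \<omega>. ennreal (X \<omega>) \<partial>M) = ennreal (expectation (\<lambda>\<omega>. max 0 (X \<omega>)))"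
    if "integrable M X" for X :: "'a \<Rightarrow> real"
  proof -
    have "(\<integral>\<^sup>+ \<omega>. ennreal (X \<omega>) \<partial>M) = (\<integral>\<^sup>+ \<omega>. ennreal (max 0 (X \<omega>)) \<partial>M)"
      by (intro nn_integral_cong) (auto simp: max_def ennreal_neg)
    also have "\<dots> = ennreal (expectation (\<lambda>\<omega>. max 0 (X \<omega>)))"
      using that by (intro nn_integral_eq_integral) auto
    finally show ?thesis .
  qed
  have "ereal_expectation M (\<lambda>\<omega>. Y \<omega> + K \<omega>) =
      ereal (expectation (\<lambda>\<omega>. max 0 (Y \<omega> + K \<omega>)) - expectation (\<lambda>\<omega>. max 0 (- (Y \<omega> + K \<omega>))))"
    unfolding ereal_expectation_def
    using part[OF int] part[OF integrable_minus[OF int]]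
    by (simp add: integral_nonneg_AE enn2ereal_ennreal)
  also have "expectation (\<lambda>\<omega>. max 0 (Y \<omega> + K \<omega>)) - expectation (\<lambda>\<omega>. max 0 (- (Y \<omega> + K \<omega>))) =
      expectation (\<lambda>\<omega>. max 0 (Y \<omega> + K \<omega>) - max 0 (- (Y \<omega> + K \<omega>)))"
    using integrable_max[OF integrable_const int, of 0]
      integrable_max[OF integrable_const integrable_minus[OF int], of 0]
    by (rule Bochner_Integration.integral_diff[symmetric])
  also have "(\<lambda>\<omega>. max 0 (Y \<omega> + K \<omega>) - max 0 (- (Y \<omega> + K \<omega>))) = (\<lambda>\<omega>. Y \<omega> + K \<omega>)"
    by (auto simp: max_def)
  finally show ?thesis using le by (simp add: Z_def)
qed


section \<open>Perturbation families\<close>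

text \<open>An integrable function whose integrals over all half-lines vanish is zero almost
  everywhere. This frees the norm from the density selected by \<open>SOME\<close> in
  \<open>cm_norm\<close>.\<close>

lemma cm_density_unique:
  fixes d d' :: "real \<Rightarrow> real ^ 'n"
  assumes cm: "cm_density h d" "cm_density h d'"
  shows "AE s in lborel. s \<in> {0..1} \<longrightarrow> d s = d' s"
proof -
  define g where "g s = indicator {0..1} s *\<^sub>R d s - indicator {0..1} s *\<^sub>R d' s" for s
  have int: "integrable lborel g"
    using cm_density_integrable(1)[OF cm(1)] cm_density_integrable(1)[OF cm(2)]
    unfolding g_def set_integrable_def by simp
  have setint: "set_integrable lborel A g" if "A \<in> sets borel" for A
    unfolding set_integrable_def by (rule integrable_mult_indicator) (use that int in auto)
  have zero: "(LINT s:{..t}|lborel. g s) = 0" for t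
  proof -
    \<comment> \<open>\<open>g\<close> vanishes outside \<open>{0..1}\<close>, so only
      \<open>{0..t'}\<close> contributes; for negative \<open>t\<close> this interval is
      empty.\<close>
    define t' where "t' = min t 1"
    have t': "t' \<le> 1" by (simp add: t'_def)
    have part: "(LINT s:{0..t'}|lborel. d s) = (LINT s:{0..t'}|lborel. d' s)"
      using cm t' unfolding cm_density_def
      by (cases "0 \<le> t'") (auto simp: set_lebesgue_integral_def)
    have "(LINT s:{..t}|lborel. g s) =
        (LINT s|lborel. indicator {0..t'} s *\<^sub>R d s - indicator {0..t'} s *\<^sub>R d' s)"
      unfolding set_lebesgue_integral_def g_def t'_def
      by (rule Bochner_Integration.integral_cong) (auto simp: indicator_def)
    also have "\<dots> = 0"
      using part set_integrable_subset[OF cm_density_integrable(1)[OF cm(1)], of "{0..t'}"]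
        set_integrable_subset[OF cm_density_integrable(1)[OF cm(2)], of "{0..t'}"] t'
      unfolding set_lebesgue_integral_def set_integrable_def
      by (subst Bochner_Integration.integral_diff) auto
    finally show ?thesis .
  qed
  have total: "(LINT s|lborel. g s) = 0"
  proof -
    have "(LINT s|lborel. g s) = (LINT s:{..1}|lborel. g s)"
      unfolding set_lebesgue_integral_def
      by (rule Bochner_Integration.integral_cong) (auto simp: g_def indicator_def)
    then show ?thesis using zero by simp
  qed
  have gen: "sets borel = sigma_sets UNIV (range (\<lambda>a::real. {..a}))"
    by (subst borel_eq_atMost) (simp add: sets_measure_of)
  \<comment> \<open>Dynkin induction: half-lines are closed under intersection and generate the
    Borel sets, and \<open>total\<close> supplies the complement step.\<close>
  have null: "(LINT s:A|lborel. g s) = 0" if "A \<in> sets lborel" for A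
  proof -
    have "Int_stable (range (\<lambda>a::real. {..a}))" by (auto simp: Int_stable_def)
    moreover have "range (\<lambda>a::real. {..a}) \<subseteq> Pow UNIV" by simp
    moreover have "A \<in> sigma_sets UNIV (range (\<lambda>a::real. {..a}))"
      using that by (simp add: gen)
    ultimately show ?thesis
    proof (induction rule: sigma_sets_induct_disjoint)
      case (compl A)
      then have A: "A \<in> sets borel" by (simp add: gen)
      have "(LINT s:A \<union> (UNIV - A)|lborel. g s) = (LINT s:A|lborel. g s) + (LINT s:UNIV - A|lborel. g s)"
        by (rule set_integral_Un) (use A in \<open>auto intro!: setint\<close>)
      then show ?case
        using total compl(2) by (simp add: set_lebesgue_integral_def)
    next
      case (union A)
      then have A: "A i \<in> sets borel" for i by (auto simp: gen)
      have "(LINT s:(\<Union>i. A i)|lborel. g s) = (\<Sum>i. (LINT s:A i|lborel. g s))"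
        using A union(1) by (intro lebesgue_integral_countable_add setint) (auto simp: disjoint_family_on_def)
      then show ?case using union(3) by simp
    qed (use zero in \<open>auto simp: set_lebesgue_integral_def\<close>)
  qed
  have "AE s in lborel. g s = 0"
    by (rule sigma_finite_measure.density_zero[OF sigma_finite_lborel int]) (rule null)
  then show ?thesis
    by eventually_elim (auto simp: g_def)
qed

lemma cm_norm_eq:
  assumes "cm_density h d"
  shows "(cm_norm h)\<^sup>2 = (LINT s:{0..1}|lborel. (norm (d s))\<^sup>2)"
proof -
  define d' where "d' = (SOME d. cm_density h d)"
  have d': "cm_density h d'" unfolding d'_def using assms by (rule someI[of "cm_density h"])
  have "(cm_norm h)\<^sup>2 = (LINT s:{0..1}|lborel. (norm (d' s))\<^sup>2)"
    unfolding cm_norm_def d'_def[symmetric] using cm_energy_nonneg by (rule real_sqrt_pow2)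
  also have "\<dots> = (LINT s:{0..1}|lborel. (norm (d s))\<^sup>2)"
    unfolding set_lebesgue_integral_def
  proof (rule integral_cong_AE)
    show "AE s in lborel. indicator {0..1} s *\<^sub>R (norm (d' s))\<^sup>2 = indicator {0..1} s *\<^sub>R (norm (d s))\<^sup>2"
      using cm_density_unique[OF d' assms] by eventually_elim (auto simp: indicator_def)
  qed (use cm_density_integrable(2)[OF assms] cm_density_integrable(2)[OF d'] in
      \<open>auto simp: set_integrable_def dest: borel_measurable_integrable\<close>)
  finally show ?thesis .
qed

lemma cm_norm_nonneg: "0 \<le> cm_norm h"
  unfolding cm_norm_def by (simp add: cm_energy_nonneg)

text \<open>The bound on the product space passes to almost every section, and since the time
  interval has length 1 the squared norm is almost surely at most \<open>C\<^sup>2\<close>.\<close>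

lemma bounded_drifts_subset_L_a:
  assumes "prob_space \<nu>"
  shows "bounded_drifts \<nu> \<subseteq> L_a 2 \<nu>"
proof
  fix u assume "u \<in> bounded_drifts \<nu>"
  then obtain d C where d: "adapted_density \<nu> u d"
    and C: "AE (w, s) in completion \<nu> \<Otimes>\<^sub>M restrict_space lborel {0..1}. norm (d w s) \<le> C"
    unfolding bounded_drifts_def by auto
  interpret prob_space "completion \<nu>" using assms by (rule prob_space.prob_space_completion)
  define L where "L = restrict_space lborel {0..1::real}"
  have L: "sigma_finite_measure L"
    unfolding L_def by (intro sigma_finite_measure_restrict_space sigma_finite_lborel) auto
  interpret L: sigma_finite_measure L by fact
  interpret P: pair_sigma_finite "completion \<nu>" L ..
  have integral_L: "(\<integral>s. q s \<partial>L) = (LINT s:{0..1}|lborel. q s)" for q :: "real \<Rightarrow> real"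
    unfolding L_def set_lebesgue_integral_def by (rule integral_restrict_space) simp
  have cmw: "cm_density (u w) (d w)" if "w \<in> space \<nu>" for w
    using d that by (simp add: adapted_density_def)
  \<comment> \<open>\<open>cm_norm\<close> chooses a density separately for each path; rewriting it
    with the jointly measurable \<open>d\<close> is what makes it measurable in
    \<open>w\<close>.\<close>
  have eq: "cm_norm (u w) powr 2 = (\<integral>s. (norm (d w s))\<^sup>2 \<partial>L)" if "w \<in> space (completion \<nu>)" for w
    using cm_norm_eq[OF cmw] that cm_norm_nonneg[of "u w"] by (simp add: integral_L)
  have dm: "(\<lambda>(w, s). d w s) \<in> borel_measurable (completion \<nu> \<Otimes>\<^sub>M L)"
    using d by (simp add: adapted_density_def L_def)
  have "(\<lambda>p. (norm (case p of (w, s) \<Rightarrow> d w s))\<^sup>2) \<in> borel_measurable (completion \<nu> \<Otimes>\<^sub>M L)"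
    by (rule measurable_compose[OF dm]) measurable
  then have "(\<lambda>(w, s). (norm (d w s))\<^sup>2) \<in> borel_measurable (completion \<nu> \<Otimes>\<^sub>M L)"
    by (simp add: split_beta')
  then have meas: "(\<lambda>w. \<integral>s. (norm (d w s))\<^sup>2 \<partial>L) \<in> borel_measurable (completion \<nu>)"
    by (rule L.borel_measurable_lebesgue_integral)
  have C': "AE w in completion \<nu>. AE s in L. norm (d w s) \<le> C"
    using P.AE_pair[OF C[folded L_def]] by simp
  have "integrable (completion \<nu>) (\<lambda>w. \<integral>s. (norm (d w s))\<^sup>2 \<partial>L)"
  proof (rule integrable_const_bound[where B="C\<^sup>2"])
    show "AE w in completion \<nu>. norm (\<integral>s. (norm (d w s))\<^sup>2 \<partial>L) \<le> C\<^sup>2"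
      using C' AE_space
    proof eventually_elim
      case (elim w)
      have 1: "integrable L (\<lambda>s. (norm (d w s))\<^sup>2)"
        using cm_density_integrable(2)[OF cmw, of w] elim(2)
        unfolding L_def set_integrable_def by (subst integrable_restrict_space) auto
      have finL: "emeasure L (space L) = 1"
        unfolding L_def by (simp add: emeasure_restrict_space space_restrict_space)
      then interpret L1: prob_space L by (rule prob_spaceI)
      have "(\<integral>s. (norm (d w s))\<^sup>2 \<partial>L) \<le> (\<integral>s. C\<^sup>2 \<partial>L)"
      proof (rule integral_mono_AE[OF 1])
        show "AE s in L. (norm (d w s))\<^sup>2 \<le> C\<^sup>2"
          using elim(1) by eventually_elim (auto intro: power_mono)
      qed simp
      also have "\<dots> = C\<^sup>2" using L1.prob_space by simp
      finally show ?case by (simp add: integral_nonneg_AE)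
    qed
  qed (rule meas)
  then have "integrable (completion \<nu>) (\<lambda>w. cm_norm (u w) powr 2)"
    by (rule Bochner_Integration.integrable_cong[THEN iffD2, OF refl, rotated]) (rule eq)
  then show "u \<in> L_a 2 \<nu>" using d by (auto simp: L_a_def)
qed

text \<open>Evaluations generate \<open>path_space\<close>, and adjoining null sets gives the
  completion. Together with \<open>bm_filtration\<close>, this makes every measurable
  \<open>f\<close> measurable for the completed filtration of \<open>\<beta>\<close> at time
  1.\<close>

lemma completion_eq_coord_filtration:
  assumes "sets \<nu> = sets path_space"
  shows "sets (completion \<nu>) = sets (coord_filtration \<nu> 1)"
proof
  have space: "space \<nu> = {w \<in> space (PiM {0..1} (\<lambda>_. borel)). continuous_on {0..1} w}"
    using sets_eq_imp_space_eq[OF assms] by (auto simp: path_space_def space_restrict_space)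
  have id: "(\<lambda>w. w) \<in> coord_filtration \<nu> 1 \<rightarrow>\<^sub>M path_space"
    unfolding path_space_def
  proof (rule measurable_restrict_space2)
    show "(\<lambda>w. w) \<in> coord_filtration \<nu> 1 \<rightarrow>\<^sub>M PiM {0..1} (\<lambda>_. borel)"
    proof (rule measurable_PiM_single')
      show "(\<lambda>w. w t) \<in> borel_measurable (coord_filtration \<nu> 1)" if "t \<in> {0..1}" for t
        unfolding coord_filtration_def by (rule measurable_completed_filtration_eval[OF that])
      show "(\<lambda>w. w) \<in> space (coord_filtration \<nu> 1) \<rightarrow> (\<Pi>\<^sub>E i\<in>{0..1}. space borel)"
        by (auto simp: coord_filtration_def space space_PiM)
    qed
  qed (auto simp: coord_filtration_def space)
  show "sets (completion \<nu>) \<subseteq> sets (coord_filtration \<nu> 1)"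
  proof
    fix A assume "A \<in> sets (completion \<nu>)"
    then obtain S N N' where A: "A = S \<union> N" "N \<subseteq> N'" "N' \<in> null_sets \<nu>" "S \<in> sets \<nu>"
      by (rule sets_completionE)
    have "S \<inter> space \<nu> \<in> sets (coord_filtration \<nu> 1)"
      using measurable_sets[OF id, of S] A(4) assms by (simp add: coord_filtration_def)
    then have "S \<in> sets (coord_filtration \<nu> 1)"
      using sets.sets_into_space[OF A(4)] by (simp add: Int_absorb2)
    moreover have "N \<in> sets (coord_filtration \<nu> 1)"
      unfolding coord_filtration_def using A(2,3)
      by (intro null_sets_completed_filtration) (auto simp: null_sets_completion_iff2)
    ultimately show "A \<in> sets (coord_filtration \<nu> 1)" unfolding A(1) by (rule sets.Un)
  qed
  have "(\<lambda>w. w) \<in> \<nu> \<rightarrow>\<^sub>M path_space"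
    using assms by (simp add: measurable_ident_sets)
  then have ev: "(\<lambda>w. w t) \<in> borel_measurable \<nu>" if "t \<in> {0..1}" for t
    by (rule measurable_path_eval[OF that])
  show "sets (coord_filtration \<nu> 1) \<subseteq> sets (completion \<nu>)"
    unfolding coord_filtration_def sets_completed_filtration
  proof (rule sets.sigma_sets_subset[of _ "completion \<nu>", unfolded space_completion], rule Un_least)
    show "{(\<lambda>w. w s) -` B \<inter> space \<nu> |s B. s \<in> {0..1} \<and> B \<in> sets borel} \<subseteq> sets (completion \<nu>)"
      using measurable_sets[OF ev] by auto
  qed auto
qed

context perturbation_family
begin

text \<open>Evaluations pull back by adaptedness of \<open>W u\<close>, null sets by hypothesis.
  Hence a process adapted to the filtration, such as \<open>\<beta>\<close>, stays adapted after
  composition with \<open>W u\<close>.\<close>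

lemma coord_filtration_shift:
  assumes u: "u \<in> Dt" and t: "t \<in> {0..1}"
    and null: "\<And>N. N \<in> null_sets (completion \<nu>) \<Longrightarrow> W u -` N \<inter> space \<nu> \<in> null_sets (completion \<nu>)"
  shows "W u \<in> coord_filtration \<nu> t \<rightarrow>\<^sub>M coord_filtration \<nu> t"
  unfolding coord_filtration_def
proof (subst (2) completed_filtration_def, rule measurable_measure_of[OF completed_filtration_gen])
  have "W u \<in> completion \<nu> \<rightarrow>\<^sub>M path_space" using W_measurable u by blast
  from measurable_space[OF this] sets_eq_imp_space_eq[OF sets_nu]
  show sp: "W u \<in> space (completed_filtration \<nu> (\<lambda>w t. w t) t) \<rightarrow> space \<nu>" by auto
  fix A assume "A \<in> {(\<lambda>\<omega>. \<omega> s) -` B \<inter> space \<nu> |s B. s \<in> {0..t} \<and> B \<in> sets borel} \<union> null_sets (completion \<nu>)"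
  then consider s B where "A = (\<lambda>\<omega>. \<omega> s) -` B \<inter> space \<nu>" "s \<in> {0..t}" "B \<in> sets borel"
    | "A \<in> null_sets (completion \<nu>)" by blast
  then show "W u -` A \<inter> space (completed_filtration \<nu> (\<lambda>w t. w t) t) \<in> sets (completed_filtration \<nu> (\<lambda>w t. w t) t)"
  proof cases
    case 1
    have "(\<lambda>w. W u w s) \<in> borel_measurable (coord_filtration \<nu> s)"
      using W_adapted u 1(2) t by simp
    then have "(\<lambda>w. W u w s) \<in> borel_measurable (completed_filtration \<nu> (\<lambda>w t. w t) t)"
      unfolding coord_filtration_def using 1(2) by (intro measurable_completed_filtration_mono[of s t]) auto
    from measurable_sets[OF this 1(3)]
    have "(\<lambda>w. W u w s) -` B \<inter> space \<nu> \<in> sets (completed_filtration \<nu> (\<lambda>w t. w t) t)" by simp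
    also have "(\<lambda>w. W u w s) -` B \<inter> space \<nu> = W u -` A \<inter> space \<nu>"
      using sp by (auto simp: 1(1))
    finally show ?thesis by simp
  next
    case 2
    then show ?thesis using null by (simp add: null_sets_completed_filtration)
  qed
qed

text \<open>By \<open>W_law\<close> the preimage of a null set has Girsanov measure 0, and the
  Girsanov density, being an exponential, vanishes nowhere.\<close>

lemma W_null_sets:
  assumes u: "u \<in> Dt" and N: "N \<in> null_sets (completion \<nu>)"
  shows "W u -` N \<inter> space \<nu> \<in> null_sets (completion \<nu>)"
proof -
  have Wm: "W u \<in> completion \<nu> \<rightarrow>\<^sub>M path_space" using W_measurable u by blast
  \<comment> \<open>\<open>W u\<close> is given as measurable into \<open>path_space\<close>, so the
    null set is first enlarged to one in \<open>sets \<nu>\<close>.\<close>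
  obtain N' where N': "N' \<in> null_sets \<nu>" "N \<subseteq> N'" using N by (auto simp: null_sets_completion_iff2)
  have N'p: "N' \<in> sets path_space" using N'(1) sets_nu by auto
  let ?g = "girsanov_exp \<nu> \<beta> u"
  have "(LINT w|completion \<nu>. ?g w) = 1" using u Dt_subset by (auto simp: G_drifts_def)
  \<comment> \<open>measurability of the exponential is not assumed: it holds since non-integrable functions have integral 0\<close>
  then have "integrable (completion \<nu>) ?g" using not_integrable_integral_eq[of "completion \<nu>" ?g] by auto
  then have gm: "?g \<in> borel_measurable (completion \<nu>)" by simp
  let ?A = "W u -` N' \<inter> space \<nu>"
  have A: "?A \<in> sets (completion \<nu>)" using measurable_sets[OF Wm N'p] by simp
  have "(\<integral>\<^sup>+ w. ennreal (?g w) * indicator ?A w \<partial>completion \<nu>) = emeasure (girsanov_measure \<nu> \<beta> u) ?A"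
    unfolding girsanov_measure_def using gm A by (simp add: emeasure_density)
  also have "\<dots> = emeasure (distr (girsanov_measure \<nu> \<beta> u) path_space (W u)) N'"
    using Wm N'p by (subst emeasure_distr) (auto simp: girsanov_measure_def)
  also have "\<dots> = emeasure (distr (completion \<nu>) path_space (\<lambda>w. w)) N'"
    using W_law u by simp
  also have "\<dots> = emeasure (completion \<nu>) (N' \<inter> space \<nu>)"
  proof -
    have "(\<lambda>w. w) \<in> completion \<nu> \<rightarrow>\<^sub>M path_space"
      by (intro measurable_completion measurable_ident_sets sets_nu)
    then show ?thesis using N'p by (subst emeasure_distr) auto
  qed
  also have "\<dots> = 0"
    using N'(1) sets.sets_into_space[of N' \<nu>] by (simp add: Int_absorb2 null_setsD1 null_setsD2)
  finally have "AE w in completion \<nu>. ennreal (?g w) * indicator ?A w = 0"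
    using gm A by (subst (asm) nn_integral_0_iff_AE) auto
  then have "AE w in completion \<nu>. w \<notin> ?A"
    by eventually_elim (auto simp: girsanov_exp_def indicator_def split: if_splits)
  then have "?A \<in> null_sets (completion \<nu>)" using A by (simp add: AE_iff_null_sets)
  then show ?thesis
    by (rule null_sets_completion_subset[rotated]) (use N'(2) in auto)
qed

lemma variational_lower_bound:
  assumes u: "u \<in> Dt \<inter> L_a 2 \<nu>"
    and f: "f \<in> borel_measurable (completion \<nu>)" and expf: "integrable (completion \<nu>) (\<lambda>w. exp (- f w))"
  shows "ereal (- ln (LINT w|completion \<nu>. exp (- f w))) \<le>
    ereal_expectation (completion \<nu>) (\<lambda>w. f (W u w) + 1 / 2 * (cm_norm (u w))\<^sup>2)"
proof -
  interpret M: prob_space "completion \<nu>" using prob by (rule prob_space.prob_space_completion)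
  have uD: "u \<in> Dt" using u by simp
  have sets1: "sets (completion \<nu>) = sets (coord_filtration \<nu> 1)"
    by (rule completion_eq_coord_filtration[OF sets_nu])
  have filt: "sets (completed_filtration (completion \<nu>) \<beta> t) = sets (coord_filtration \<nu> t)" if "t \<in> {0..1}" for t
    using bm_filtration that by (simp add: sets_completed_filtration_completion)
  note shift = coord_filtration_shift[OF uD _ W_null_sets[OF uD]]
  have T: "W u \<in> completion \<nu> \<rightarrow>\<^sub>M completion \<nu>"
    using shift[of 1] measurable_cong_sets[OF sets1 sets1] by simp
  have T_null: "AE w in completion \<nu>. P (W u w)" if P: "AE w in completion \<nu>. P w" for P
  proof -
    obtain N where N: "{w \<in> space (completion \<nu>). \<not> P w} \<subseteq> N" "N \<in> null_sets (completion \<nu>)"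
      using P unfolding eventually_ae_filter by blast
    have "{w \<in> space (completion \<nu>). \<not> P (W u w)} \<subseteq> W u -` N \<inter> space \<nu>"
      using N(1) measurable_space[OF T] by auto
    then show ?thesis using W_null_sets[OF uD N(2)] unfolding eventually_ae_filter by blast
  qed
  \<comment> \<open>Written as a difference of values of \<open>\<beta>\<close>, the shift is
    adapted at every time by \<open>coord_filtration_shift\<close>; \<open>beta_W\<close> identifies
    it with \<open>u\<close> almost surely.\<close>
  define v where "v w t = \<beta> (W u w) t - \<beta> w t" for w t
  define K where "K w = (cm_norm (u w))\<^sup>2" for w
  obtain d where d: "adapted_density \<nu> u d" using u by (auto simp: L_a_def)
  have betaT: "AE w in completion \<nu>. \<beta> (W u w) = path_add (\<beta> w) (u w)" using beta_W uD by blast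
  have K: "integrable (completion \<nu>) K"
  proof -
    have "K = (\<lambda>w. cm_norm (u w) powr 2)" by (simp add: fun_eq_iff K_def cm_norm_nonneg)
    then show ?thesis using u by (simp add: L_a_def)
  qed
  have vG: "(\<lambda>w. v w t) \<in> borel_measurable (completed_filtration (completion \<nu>) \<beta> t)" if t: "t \<in> {0..1}" for t
  proof -
    have "(\<lambda>w. \<beta> w t) \<in> borel_measurable (completed_filtration (completion \<nu>) \<beta> t)"
      using t by (intro measurable_completed_filtration_eval) auto
    then have 1: "(\<lambda>w. \<beta> w t) \<in> borel_measurable (coord_filtration \<nu> t)"
      using measurable_cong_sets[OF filt[OF t] refl] by blast
    from borel_measurable_diff[OF measurable_compose[OF shift[OF t] 1] 1]
    show ?thesis
      unfolding v_def using measurable_cong_sets[OF filt[OF t] refl] by blast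
  qed
  have cm: "AE w in completion \<nu>. \<exists>h d. cm_density h d \<and> (\<forall>t\<in>{0..1}. v w t = h t) \<and>
      (LINT r:{0..1}|lborel. (norm (d r))\<^sup>2) \<le> K w"
    using betaT AE_space
  proof eventually_elim
    case (elim w)
    have "cm_density (u w) (d w)" using d elim(2) by (simp add: adapted_density_def)
    moreover have "\<forall>t\<in>{0..1}. v w t = u w t" by (simp add: v_def elim(1) path_add_def)
    ultimately show ?case using cm_norm_eq[of "u w" "d w"] by (auto simp: K_def)
  qed
  have betav: "AE w in completion \<nu>. \<beta> (W u w) = path_add (\<beta> w) (v w)"
    using betaT by eventually_elim (auto simp: path_add_def v_def fun_eq_iff)
  \<comment> \<open>Here \<open>h\<close> is \<open>- f\<close> clamped to
    \<open>[- real k, real k]\<close>; the sign turns the upper bound for \<open>h\<close> into a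
    lower bound for \<open>f\<close>.\<close>
  have bound: "M.expectation (\<lambda>w. max (- real k) (min (real k) (- f (W u w)))) \<le>
      ln (M.expectation (\<lambda>w. exp (max (- real k) (min (real k) (- f w))))) + M.expectation K / 2" for k
    by (rule M.bounded_variational_bound[OF bm vG _ cm K T T_null betav, of _ "real k"])
      (use f sets1 filt[of 1] in auto)
  have "integrable (completion \<nu>) (\<lambda>w. 1 / 2 * K w)" using K by simp
  from M.clamped_variational_bound_imp[OF f expf measurable_compose[OF T f] this] bound
  show ?thesis unfolding K_def by simp
qed

end

theorem theorem9:
  fixes \<nu> :: "(real \<Rightarrow> real ^ 'n) measure"
    and \<beta> :: "(real \<Rightarrow> real ^ 'n) \<Rightarrow> real \<Rightarrow> real ^ 'n"
    and W :: "((real \<Rightarrow> real ^ 'n) \<Rightarrow> real \<Rightarrow> real ^ 'n) \<Rightarrow> (real \<Rightarrow> real ^ 'n) \<Rightarrow> real \<Rightarrow> real ^ 'n"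
    and Dt :: "((real \<Rightarrow> real ^ 'n) \<Rightarrow> real \<Rightarrow> real ^ 'n) set"
    and f :: "(real \<Rightarrow> real ^ 'n) \<Rightarrow> real"
  assumes "perturbation_family \<nu> \<beta> W Dt"
    and "f \<in> borel_measurable (completion \<nu>)"
    and "integrable (completion \<nu>) (\<lambda>w. (\<bar>f w\<bar> + 1) * exp (- f w))"
    and "ereal (- ln (LINT w|completion \<nu>. exp (- f w))) =
      (INF u\<in>invertible_drifts \<nu> W.
         ereal_expectation (completion \<nu>) (\<lambda>w. f (W u w) + 1 / 2 * (cm_norm (u w))\<^sup>2))"
  shows "ereal (- ln (LINT w|completion \<nu>. exp (- f w))) =
      (INF u\<in>Dt \<inter> L_a 2 \<nu>.
         ereal_expectation (completion \<nu>) (\<lambda>w. f (W u w) + 1 / 2 * (cm_norm (u w))\<^sup>2))"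
proof (rule antisym)
  interpret perturbation_family \<nu> \<beta> W Dt by fact
  \<comment> \<open>The factor \<open>\<bar>f w\<bar> + 1\<close> is at least 1, so the assumed
    integrable function dominates.\<close>
  have "integrable (completion \<nu>) (\<lambda>w. exp (- f w))"
  proof (rule Bochner_Integration.integrable_bound[OF assms(3)])
    show "AE w in completion \<nu>. norm (exp (- f w)) \<le> norm ((\<bar>f w\<bar> + 1) * exp (- f w))"
      by (simp add: abs_mult)
  qed (use assms(2) in simp)
  then show "ereal (- ln (LINT w|completion \<nu>. exp (- f w))) \<le>
      (INF u\<in>Dt \<inter> L_a 2 \<nu>.
         ereal_expectation (completion \<nu>) (\<lambda>w. f (W u w) + 1 / 2 * (cm_norm (u w))\<^sup>2))"
    by (intro INF_greatest variational_lower_bound assms(2))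
  have "invertible_drifts \<nu> W \<subseteq> Dt \<inter> L_a 2 \<nu>"
    using D_subset bounded_drifts_subset_L_a[OF prob] by (auto simp: invertible_drifts_def)
  then show "(INF u\<in>Dt \<inter> L_a 2 \<nu>.
         ereal_expectation (completion \<nu>) (\<lambda>w. f (W u w) + 1 / 2 * (cm_norm (u w))\<^sup>2)) \<le>
      ereal (- ln (LINT w|completion \<nu>. exp (- f w)))"
    unfolding assms(4) by (rule INF_superset_mono) simp
qed


end
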